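(* Let $M^m$ be a compact proper biharmonic submanifold of the unit Euclidean sphere $\mathbb{S}^n$ with constant mean curvature $|H|\in(0,1)$. Then (i) $\lambda_1\leq m(1-|H|)$, where $\lambda_1$ is the first non-zero eigenvalue of the Laplacian on $M$; (ii) if $\mathrm{Ricci}(X,X)\geq c\,g(X,X)$ for all $X\in C(TM)$, where $c>0$, then $c\leq (m-1)(1-|H|)$.
   Context: For a smooth map $\phi:(M,g)\to(N,h)$ between Riemannian manifolds, the tension field is $\tau(\phi)=\operatorname{trace}\nabla d\phi$; $\phi$ is harmonic if $\tau(\phi)=0$, and biharmonic if its bitension field vanishes: $$\tau_2(\phi)=-\Delta\tau(\phi)-\operatorname{trace}R^N(d\phi(\cdot),\tau(\phi))d\phi(\cdot)=0,$$ where $\Delta=-\operatorname{trace}\nabla^2$ is the rough Laplacian on sections of $\phi^{-1}TN$ and $R^N(X,Y)=[\nabla_X,\nabla_Y]-\nabla_{[X,Y]}$. A submanifold $M$ of $N$ is proper biharmonic if its inclusion map (with the induced metric) is biharmonic but not harmonic (equivalently, biharmonic and not minimal). $M^m$ is an $m$-dimensional submanifold with induced metric $g$ and Ricci curvature $\mathrm{Ricci}$; $H=\frac1m\operatorname{trace}B$ is its mean curvature vector field in $\mathbb{S}^n$, where $B$ is the second fundamental form; "constant mean curvature" means that $|H|$ is constant. The Laplacian on functions on $M$ is taken with the sign making its eigenvalues non-negative, $\Delta=-\operatorname{div}\operatorname{grad}$. $C(TM)$ denotes the smooth vector fields on $M$. *)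

theory Defs
  imports "HOL-Analysis.Analysis"
begin

section \<open>Submanifolds of Euclidean spaces\<close>

primrec Ck_on :: "nat \<Rightarrow> ('a::euclidean_space \<Rightarrow> 'b::real_normed_vector) \<Rightarrow> 'a set \<Rightarrow> bool" where
  "Ck_on 0 f U \<longleftrightarrow> continuous_on U f"
| "Ck_on (Suc k) f U \<longleftrightarrow> (\<forall>x\<in>U. f differentiable (at x)) \<and>
     (\<forall>v. Ck_on k (\<lambda>x. frechet_derivative f (at x) v) U)"

text \<open>Smoothness on an arbitrary subset \<open>A\<close>: local extendability to a \<open>C\<^sup>\<infinity>\<close> map on an
  open subset of the ambient space.\<close>

definition smooth_on :: "'a set \<Rightarrow> ('a::euclidean_space \<Rightarrow> 'b::real_normed_vector) \<Rightarrow> bool" where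
  "smooth_on A f \<longleftrightarrow> (\<forall>p\<in>A. \<exists>U F. open U \<and> p \<in> U \<and> (\<forall>k. Ck_on k F U) \<and> (\<forall>x\<in>A \<inter> U. F x = f x))"

text \<open>Every point of \<open>M\<close> has a neighbourhood in \<open>M\<close> that is diffeomorphic to an open subset of
  \<open>\<real>\<^sup>m\<close>. To have \<open>m\<close> as a natural number rather than as an index type, \<open>\<real>\<^sup>m\<close> is taken to be some
  \<open>m\<close>-dimensional linear subspace \<open>E\<close> of the ambient space. The dimension is the same at all points;
  connectedness is not required.\<close>

definition submanifold :: "nat \<Rightarrow> 'a::euclidean_space set \<Rightarrow> bool" where
  "submanifold m M \<longleftrightarrow> (\<forall>p\<in>M. \<exists>W (E :: 'a set) U \<psi> \<theta>.
     open W \<and> p \<in> W \<and> subspace E \<and> dim E = m \<and> openin (top_of_set E) U \<and>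
     homeomorphism U (M \<inter> W) \<psi> \<theta> \<and> smooth_on U \<psi> \<and> smooth_on (M \<inter> W) \<theta>)"

text \<open>Velocities at \<open>p\<close> of curves in \<open>M\<close>.\<close>

definition tangent_space :: "'a::euclidean_space set \<Rightarrow> 'a \<Rightarrow> 'a set" where
  "tangent_space M p = {v. \<exists>\<gamma> \<epsilon>. \<epsilon> > 0 \<and> \<gamma> 0 = p \<and> (\<forall>t. \<bar>t\<bar> < \<epsilon> \<longrightarrow> \<gamma> t \<in> M) \<and>
     (\<gamma> has_vector_derivative v) (at (0::real))}"

text \<open>The differential of \<open>f\<close>, defined on \<open>M\<close>, at \<open>p \<in> M\<close>. The derivative within \<open>M\<close> is not unique as
  a linear map on the ambient space, but its values on \<open>tangent_space M p\<close> are
  (lemma \<open>mderiv_along_curve\<close>), and it is applied to tangent vectors only.\<close>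

definition mderiv :: "'a::euclidean_space set \<Rightarrow> ('a \<Rightarrow> 'b::real_normed_vector) \<Rightarrow> 'a \<Rightarrow> 'a \<Rightarrow> 'b" where
  "mderiv M f p v = frechet_derivative f (at p within M) v"

lemma mderiv_along_curve:
  assumes f: "(f has_derivative D) (at p within M)"
    and \<gamma>: "\<epsilon> > 0" "\<gamma> 0 = p" "\<And>t. \<bar>t\<bar> < \<epsilon> \<Longrightarrow> \<gamma> t \<in> M" "(\<gamma> has_vector_derivative v) (at (0::real))"
  shows "mderiv M f p v = D v" and "((\<lambda>t. f (\<gamma> t)) has_vector_derivative mderiv M f p v) (at 0)"
proof -
  have curve: "((\<lambda>t. f (\<gamma> t)) has_vector_derivative F v) (at 0)"
    if F: "(f has_derivative F) (at p within M)" for F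
  proof -
    have D1: "(\<gamma> has_derivative (\<lambda>t. t *\<^sub>R v)) (at 0 within {-\<epsilon><..<\<epsilon>})"
      using \<gamma>(4) unfolding has_vector_derivative_def by (rule has_derivative_at_withinI)
    have sub: "\<gamma> ` {-\<epsilon><..<\<epsilon>} \<subseteq> M"
    proof
      fix y assume "y \<in> \<gamma> ` {-\<epsilon><..<\<epsilon>}"
      then obtain t where "\<bar>t\<bar> < \<epsilon>" "y = \<gamma> t"
        by (metis abs_less_iff greaterThanLessThan_iff imageE minus_less_iff)
      then show "y \<in> M"
        using \<gamma>(3) by blast
    qed
    have D2: "(f has_derivative F) (at (\<gamma> 0) within \<gamma> ` {-\<epsilon><..<\<epsilon>})"
      unfolding \<gamma>(2) using F sub by (rule has_derivative_subset)
    have "((\<lambda>t. f (\<gamma> t)) has_derivative (\<lambda>t. F (t *\<^sub>R v))) (at 0 within {-\<epsilon><..<\<epsilon>})"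
      by (rule has_derivative_in_compose[OF D1 D2])
    moreover have "at 0 within {-\<epsilon><..<\<epsilon>} = at (0::real)"
      using \<gamma>(1) by (intro at_within_open) auto
    moreover have "F (t *\<^sub>R v) = t *\<^sub>R F v" for t
      by (rule linear_cmul[OF has_derivative_linear[OF F]])
    ultimately show ?thesis
      by (simp only: has_vector_derivative_def)
  qed
  have *: "(f has_derivative frechet_derivative f (at p within M)) (at p within M)"
    using f frechet_derivative_works[of f "at p within M"] unfolding differentiable_def by blast
  show "((\<lambda>t. f (\<gamma> t)) has_vector_derivative mderiv M f p v) (at 0)"
    unfolding mderiv_def by (rule curve[OF *])
  with curve[OF f] show "mderiv M f p v = D v"
    by (blast intro: vector_derivative_unique_at)
qed

definition smooth_vector_field :: "'a::euclidean_space set \<Rightarrow> ('a \<Rightarrow> 'a) \<Rightarrow> bool" where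
  "smooth_vector_field M X \<longleftrightarrow> smooth_on M X \<and> (\<forall>p\<in>M. X p \<in> tangent_space M p)"

text \<open>Orthogonal projection onto the tangent space.\<close>

definition tang :: "'a::euclidean_space set \<Rightarrow> 'a \<Rightarrow> 'a \<Rightarrow> 'a" where
  "tang M p v = closest_point (tangent_space M p) v"

text \<open>For \<open>v\<close> tangent to \<open>M\<close> at \<open>p\<close>, \<open>tfield M v\<close> is a smooth vector field on \<open>M\<close> with value \<open>v\<close> at
  \<open>p\<close>. It serves to evaluate at tangent vectors the expressions below that are tensorial in some
  of their vector field arguments.\<close>

abbreviation tfield :: "'a::euclidean_space set \<Rightarrow> 'a \<Rightarrow> 'a \<Rightarrow> 'a" where
  "tfield M v \<equiv> (\<lambda>q. tang M q v)"

definition orthonormal_basis :: "'a::euclidean_space set \<Rightarrow> 'a set \<Rightarrow> bool" where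
  "orthonormal_basis E B \<longleftrightarrow> B \<subseteq> E \<and> pairwise orthogonal B \<and> (\<forall>e\<in>B. norm e = 1) \<and> span B = E"

text \<open>Trace over \<open>T\<^sub>pM\<close> of a bilinear map \<open>b\<close>, given through \<open>q e = b e e\<close>.\<close>

definition trace_at :: "'a::euclidean_space set \<Rightarrow> 'a \<Rightarrow> ('a \<Rightarrow> 'b::real_vector) \<Rightarrow> 'b" where
  "trace_at M p q = (\<Sum>e\<in>(SOME B. orthonormal_basis (tangent_space M p) B). q e)"


section \<open>Connections and curvature\<close>

text \<open>All submanifolds carry the metric induced by the ambient inner product. The Levi-Civita
  connection of \<open>N\<close> is the tangential part of the ambient derivative. Accordingly, for \<open>\<phi> : M \<rightarrow> N\<close>
  and a section \<open>V\<close> of \<open>\<phi>\<^sup>-\<^sup>1TN\<close> (so \<open>V p \<in> T\<^bsub>\<phi>(p)\<^esub>N\<close>), the pull-back connection is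
  \<open>(\<nabla>\<^sub>XV)(p) = (dV\<^sub>p(X p))\<close> projected to \<open>T\<^bsub>\<phi>(p)\<^esub>N\<close>.\<close>

definition conn :: "'a::euclidean_space set \<Rightarrow> 'b::euclidean_space set \<Rightarrow> ('a \<Rightarrow> 'b) \<Rightarrow>
    ('a \<Rightarrow> 'a) \<Rightarrow> ('a \<Rightarrow> 'b) \<Rightarrow> 'a \<Rightarrow> 'b" where
  "conn M N \<phi> X V = (\<lambda>p. tang N (\<phi> p) (mderiv M V p (X p)))"

definition levi_civita :: "'a::euclidean_space set \<Rightarrow> ('a \<Rightarrow> 'a) \<Rightarrow> ('a \<Rightarrow> 'a) \<Rightarrow> 'a \<Rightarrow> 'a" where
  "levi_civita M = conn M M (\<lambda>x. x)"

definition lie_bracket :: "'a::euclidean_space set \<Rightarrow> ('a \<Rightarrow> 'a) \<Rightarrow> ('a \<Rightarrow> 'a) \<Rightarrow> 'a \<Rightarrow> 'a" where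
  "lie_bracket M X Y = (\<lambda>p. mderiv M Y p (X p) - mderiv M X p (Y p))"

definition curvature :: "'a::euclidean_space set \<Rightarrow> ('a \<Rightarrow> 'a) \<Rightarrow> ('a \<Rightarrow> 'a) \<Rightarrow> ('a \<Rightarrow> 'a) \<Rightarrow> 'a \<Rightarrow> 'a" where
  "curvature M X Y Z = (\<lambda>p. levi_civita M X (levi_civita M Y Z) p
     - levi_civita M Y (levi_civita M X Z) p - levi_civita M (lie_bracket M X Y) Z p)"

definition curvature_at :: "'a::euclidean_space set \<Rightarrow> 'a \<Rightarrow> 'a \<Rightarrow> 'a \<Rightarrow> 'a \<Rightarrow> 'a" where
  "curvature_at M p u v w = curvature M (tfield M u) (tfield M v) (tfield M w) p"

definition ricci :: "'a::euclidean_space set \<Rightarrow> ('a \<Rightarrow> 'a) \<Rightarrow> ('a \<Rightarrow> 'a) \<Rightarrow> 'a \<Rightarrow> real" where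
  "ricci M X Y = (\<lambda>p. trace_at M p (\<lambda>e. curvature M (tfield M e) X Y p \<bullet> e))"


section \<open>Tension field, bitension field, mean curvature\<close>

definition pushforward :: "'a::euclidean_space set \<Rightarrow> ('a \<Rightarrow> 'b::euclidean_space) \<Rightarrow> ('a \<Rightarrow> 'a) \<Rightarrow> 'a \<Rightarrow> 'b" where
  "pushforward M \<phi> X = (\<lambda>p. mderiv M \<phi> p (X p))"

text \<open>\<open>(\<nabla>d\<phi>)(X, Y)\<close>.\<close>

definition hess_map :: "'a::euclidean_space set \<Rightarrow> 'b::euclidean_space set \<Rightarrow> ('a \<Rightarrow> 'b) \<Rightarrow>
    ('a \<Rightarrow> 'a) \<Rightarrow> ('a \<Rightarrow> 'a) \<Rightarrow> 'a \<Rightarrow> 'b" where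
  "hess_map M N \<phi> X Y = (\<lambda>p. conn M N \<phi> X (pushforward M \<phi> Y) p - pushforward M \<phi> (levi_civita M X Y) p)"

definition tension :: "'a::euclidean_space set \<Rightarrow> 'b::euclidean_space set \<Rightarrow> ('a \<Rightarrow> 'b) \<Rightarrow> 'a \<Rightarrow> 'b" where
  "tension M N \<phi> = (\<lambda>p. trace_at M p (\<lambda>e. hess_map M N \<phi> (tfield M e) (tfield M e) p))"

definition rough_laplacian :: "'a::euclidean_space set \<Rightarrow> 'b::euclidean_space set \<Rightarrow> ('a \<Rightarrow> 'b) \<Rightarrow>
    ('a \<Rightarrow> 'b) \<Rightarrow> 'a \<Rightarrow> 'b" where
  "rough_laplacian M N \<phi> V = (\<lambda>p. - trace_at M p (\<lambda>e.
     conn M N \<phi> (tfield M e) (conn M N \<phi> (tfield M e) V) p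
     - conn M N \<phi> (levi_civita M (tfield M e) (tfield M e)) V p))"

definition bitension :: "'a::euclidean_space set \<Rightarrow> 'b::euclidean_space set \<Rightarrow> ('a \<Rightarrow> 'b) \<Rightarrow> 'a \<Rightarrow> 'b" where
  "bitension M N \<phi> = (\<lambda>p. - rough_laplacian M N \<phi> (tension M N \<phi>) p
     - trace_at M p (\<lambda>e. curvature_at N (\<phi> p) (mderiv M \<phi> p e) (tension M N \<phi> p) (mderiv M \<phi> p e)))"

definition harmonic_map :: "'a::euclidean_space set \<Rightarrow> 'b::euclidean_space set \<Rightarrow> ('a \<Rightarrow> 'b) \<Rightarrow> bool" where
  "harmonic_map M N \<phi> \<longleftrightarrow> (\<forall>p\<in>M. tension M N \<phi> p = 0)"

definition biharmonic_map :: "'a::euclidean_space set \<Rightarrow> 'b::euclidean_space set \<Rightarrow> ('a \<Rightarrow> 'b) \<Rightarrow> bool" where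
  "biharmonic_map M N \<phi> \<longleftrightarrow> (\<forall>p\<in>M. bitension M N \<phi> p = 0)"

definition proper_biharmonic :: "'a::euclidean_space set \<Rightarrow> 'a set \<Rightarrow> bool" where
  "proper_biharmonic M N \<longleftrightarrow> biharmonic_map M N (\<lambda>x. x) \<and> \<not> harmonic_map M N (\<lambda>x. x)"

text \<open>Second fundamental form of \<open>M \<subseteq> N\<close> by the Gauss formula. In the term
  \<open>\<nabla>\<^sup>N\<^sub>XY\<close> the field \<open>Y\<close> is defined along \<open>M\<close> only, so the connection along the inclusion is used.\<close>

definition second_fundamental_form :: "'a::euclidean_space set \<Rightarrow> 'a set \<Rightarrow>
    ('a \<Rightarrow> 'a) \<Rightarrow> ('a \<Rightarrow> 'a) \<Rightarrow> 'a \<Rightarrow> 'a" where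
  "second_fundamental_form M N X Y = (\<lambda>p. conn M N (\<lambda>x. x) X Y p - levi_civita M X Y p)"

definition mean_curvature :: "nat \<Rightarrow> 'a::euclidean_space set \<Rightarrow> 'a set \<Rightarrow> 'a \<Rightarrow> 'a" where
  "mean_curvature m M N = (\<lambda>p. (1 / real m) *\<^sub>R
     trace_at M p (\<lambda>e. second_fundamental_form M N (tfield M e) (tfield M e) p))"


section \<open>The Laplacian on functions\<close>

definition gradient :: "'a::euclidean_space set \<Rightarrow> ('a \<Rightarrow> real) \<Rightarrow> 'a \<Rightarrow> 'a" where
  "gradient M f = (\<lambda>p. THE w. w \<in> tangent_space M p \<and> (\<forall>v\<in>tangent_space M p. w \<bullet> v = mderiv M f p v))"

definition divergence :: "'a::euclidean_space set \<Rightarrow> ('a \<Rightarrow> 'a) \<Rightarrow> 'a \<Rightarrow> real" where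
  "divergence M X = (\<lambda>p. trace_at M p (\<lambda>e. levi_civita M (tfield M e) X p \<bullet> e))"

definition laplacian :: "'a::euclidean_space set \<Rightarrow> ('a \<Rightarrow> real) \<Rightarrow> 'a \<Rightarrow> real" where
  "laplacian M f = (\<lambda>p. - divergence M (gradient M f) p)"

definition laplace_eigenvalue :: "'a::euclidean_space set \<Rightarrow> real \<Rightarrow> bool" where
  "laplace_eigenvalue M \<mu> \<longleftrightarrow> (\<exists>f. smooth_on M f \<and> (\<exists>p\<in>M. f p \<noteq> 0) \<and> (\<forall>p\<in>M. laplacian M f p = \<mu> * f p))"

text \<open>For compact \<open>M\<close> of positive dimension the spectrum is a discrete unbounded subset of
  \<open>[0, \<infinity>)\<close>, so the infimum is the least non-zero eigenvalue.\<close>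

definition first_eigenvalue :: "'a::euclidean_space set \<Rightarrow> real" where
  "first_eigenvalue M = Inf {\<mu>. \<mu> \<noteq> 0 \<and> laplace_eigenvalue M \<mu>}"

end

theory Submission
  imports Defs
begin

text \<open>
  Write \<open>x\<close> for the position vector, \<open>\<tau> = mH\<close> for the tension field and \<open>Lap\<close> for the trace of the
  Hessian. Then \<open>Lap x = \<tau> - m x\<close>, and since \<open>\<tau>\<close> is normal to \<open>M\<close> the bitension field is
  \<open>Lap \<tau> - |\<tau>|\<^sup>2 x + m \<tau>\<close>. If it vanishes and \<open>|\<tau>| = m h\<close>, the map \<open>y = \<tau> + m h x\<close> satisfies
  \<open>Lap y = - m (1 - h) y\<close> and has constant length \<open>|y|\<^sup>2 = 2 (m h)\<^sup>2\<close>. So \<open>m (1 - h)\<close> is an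
  eigenvalue; it bounds the infimum from above because no eigenvalue is negative, by the maximum
  principle. For (ii), the Bochner formulas of the components of \<open>y\<close> are added: the divergence terms
  combine to half the Laplacian of the constant \<open>|dy|\<^sup>2\<close>, and Lichnerowicz' estimate follows
  pointwise, without integration.

  The Laplacian is \<open>\<Sum>a. D\<^sub>a D\<^sub>a\<close>, where \<open>a\<close> runs through an orthonormal basis of the ambient space
  and \<open>D\<^sub>a\<close> is the derivative along the tangential projection of \<open>a\<close>; this avoids local frames.
\<close>

section \<open>Calculus of smooth maps\<close>

text \<open>The map \<open>y\<close> comes from linear algebra: for a biharmonic inclusion the span
  of \<open>\<tau>\<close> and \<open>x\<close> is invariant under \<open>Lap\<close>, and
  \<open>\<tau> + a x\<close> is an eigenvector exactly when
  \<open>a\<^sup>2 = (m h)\<^sup>2\<close>. The root \<open>a = m h\<close> gives the eigenvalue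
  \<open>m (1 - h)\<close>, the other one \<open>m (1 + h)\<close>. The length is constant because
  \<open>\<tau>\<close> and \<open>x\<close> are orthogonal. In (ii) the dimension enters through
  \<open>|Hess f|\<^sup>2 \<ge> (Lap f)\<^sup>2 / m\<close>, which yields
  \<open>c \<le> (1 - 1/m) \<mu>\<close>; with \<open>\<mu> = m (1 - h)\<close> this is the stated
  bound. The obstacle is that \<open>M\<close> is a mere subset of the ambient space. A derivative
  within it is determined on tangent vectors only, and the basis behind \<open>trace_at\<close> is
  selected separately at each point, so a trace cannot be differentiated through it. Charts are used
  once, to construct local retractions and to show that the tangential projection is smooth; the
  later calculus rests on these two facts.\<close>

lemma frechet_derivative_eq:
  "(f has_derivative f') (at x) \<Longrightarrow> frechet_derivative f (at x) = f'"
  by (metis frechet_derivative_at)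

text \<open>The derivative at a point sees a whole neighbourhood; as \<open>U\<close> is open,
  equality on \<open>U\<close> passes to derivatives of every order.\<close>

lemma Ck_on_cong:
  assumes "open U" and "\<And>x. x \<in> U \<Longrightarrow> f x = g x" and "Ck_on k f U"
  shows "Ck_on k g U"
  using assms(2,3)
proof (induction k arbitrary: f g)
  case 0
  then show ?case
    using continuous_on_cong[of U U f g] by simp
next
  case (Suc k)
  have der: "(g has_derivative frechet_derivative f (at x)) (at x)" if "x \<in> U" for x
  proof -
    have "(f has_derivative frechet_derivative f (at x)) (at x)"
      using Suc.prems(2) that by (simp add: frechet_derivative_works[symmetric])
    then show ?thesis
      using assms(1) that Suc.prems(1) by (rule has_derivative_transform_within_open)
  qed
  then have "frechet_derivative f (at x) v = frechet_derivative g (at x) v" if "x \<in> U" for x v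
    using frechet_derivative_eq[OF der[OF that]] by simp
  with Suc have "Ck_on k (\<lambda>x. frechet_derivative g (at x) v) U" for v
    by (metis (no_types, lifting) Ck_on.simps(2))
  with der show ?case
    by (auto simp: differentiable_def)
qed

lemma Ck_on_subset: "Ck_on k f U \<Longrightarrow> V \<subseteq> U \<Longrightarrow> Ck_on k f V"
  by (induction k arbitrary: f) (auto intro: continuous_on_subset)

lemma Ck_on_SucD: "Ck_on (Suc k) f U \<Longrightarrow> Ck_on k f U"
proof (induction k arbitrary: f)
  case 0
  then show ?case
    by (auto intro!: continuous_at_imp_continuous_on differentiable_imp_continuous_within)
qed auto

text \<open>The induction steps below produce derivatives as explicit formulas; this rule accepts
  such a formula in place of \<open>frechet_derivative\<close>.\<close>

lemma Ck_on_SucI: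
  assumes "open U" and "\<And>x. x \<in> U \<Longrightarrow> (f has_derivative f' x) (at x)"
    and "\<And>v. Ck_on k (\<lambda>x. f' x v) U"
  shows "Ck_on (Suc k) f U"
proof -
  have "Ck_on k (\<lambda>x. frechet_derivative f (at x) v) U" for v
    using assms(1) _ assms(3)[of v] by (rule Ck_on_cong) (simp add: frechet_derivative_eq[OF assms(2)])
  with assms(2) show ?thesis
    by (auto simp: differentiable_def)
qed

lemma Ck_on_SucE:
  assumes "Ck_on (Suc k) f U" "x \<in> U"
  shows "(f has_derivative frechet_derivative f (at x)) (at x)"
  using assms by (simp add: frechet_derivative_works[symmetric])

lemma Ck_on_const: "Ck_on k (\<lambda>x. c) U"
  by (induction k arbitrary: c) auto

lemma Ck_on_bounded_linear:
  assumes "bounded_linear L"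
  shows "Ck_on k L U"
proof (cases k)
  case 0
  then show ?thesis
    using assms linear_continuous_on by auto
next
  case (Suc l)
  have L: "(L has_derivative L) (at x)" for x
    by (rule bounded_linear_imp_has_derivative[OF assms])
  then show ?thesis
    unfolding Suc by (auto simp: frechet_derivative_eq[OF L] Ck_on_const differentiable_def)
qed

lemma Ck_on_add:
  assumes "open U" "Ck_on k f U" "Ck_on k g U"
  shows "Ck_on k (\<lambda>x. f x + g x) U"
  using assms(2,3)
proof (induction k arbitrary: f g)
  case 0
  then show ?case
    by (simp add: continuous_on_add)
next
  case (Suc k)
  show ?case
  proof (rule Ck_on_SucI[OF assms(1)])
    show "((\<lambda>x. f x + g x) has_derivative (\<lambda>v. frechet_derivative f (at x) v + frechet_derivative g (at x) v)) (at x)"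
      if "x \<in> U" for x
      using Suc.prems that by (intro has_derivative_add Ck_on_SucE)
    show "Ck_on k (\<lambda>x. frechet_derivative f (at x) v + frechet_derivative g (at x) v) U" for v
      using Suc by simp
  qed
qed

lemma Ck_on_sum:
  assumes "open U" "finite I" "\<And>i. i \<in> I \<Longrightarrow> Ck_on k (f i) U"
  shows "Ck_on k (\<lambda>x. \<Sum>i\<in>I. f i x) U"
  using assms(2,3) by (induction I) (auto simp: Ck_on_const intro!: Ck_on_add[OF assms(1)])

lemma (in bounded_bilinear) Ck_on_bilinear:
  assumes "open U" "Ck_on k f U" "Ck_on k g U"
  shows "Ck_on k (\<lambda>x. prod (f x) (g x)) U"
  using assms(2,3)
proof (induction k arbitrary: f g)
  case 0
  then show ?case
    by (simp add: continuous_on)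
next
  case (Suc k)
  show ?case
  proof (rule Ck_on_SucI[OF assms(1)])
    show "((\<lambda>x. prod (f x) (g x)) has_derivative
        (\<lambda>v. prod (f x) (frechet_derivative g (at x) v) + prod (frechet_derivative f (at x) v) (g x))) (at x)"
      if "x \<in> U" for x
      using Suc.prems that by (intro FDERIV Ck_on_SucE)
    show "Ck_on k (\<lambda>x. prod (f x) (frechet_derivative g (at x) v) + prod (frechet_derivative f (at x) v) (g x)) U" for v
      using Suc.prems Suc.prems[THEN Ck_on_SucD] by (intro Ck_on_add[OF assms(1)] Suc.IH) simp_all
  qed
qed

lemmas Ck_on_scaleR = bounded_bilinear.Ck_on_bilinear[OF bounded_bilinear_scaleR]
lemmas Ck_on_mult = bounded_bilinear.Ck_on_bilinear[OF bounded_bilinear_mult]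
lemmas Ck_on_inner = bounded_bilinear.Ck_on_bilinear[OF bounded_bilinear_inner]

text \<open>\<open>Ck_on\<close> differentiates in constant directions only. Expanding a varying
  direction in coordinates turns the derivative along it into a finite sum of products.\<close>

lemma linear_euclidean_expansion:
  fixes L :: "'a::euclidean_space \<Rightarrow> 'b::real_vector"
  assumes "linear L"
  shows "L v = (\<Sum>b\<in>Basis. (v \<bullet> b) *\<^sub>R L b)"
proof -
  have "L v = L (\<Sum>b\<in>Basis. (v \<bullet> b) *\<^sub>R b)"
    by (simp add: euclidean_representation)
  then show ?thesis
    by (simp only: linear_sum[OF assms] linear_cmul[OF assms])
qed

text \<open>The chain rule evaluates the derivative of \<open>F\<close> in a direction that moves
  with the point. After expansion in \<open>Basis\<close> the factors coming from \<open>F\<close>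
  are derivatives in constant directions, composed with \<open>G\<close>; the induction hypothesis
  covers them because it is stated for all \<open>F\<close>.\<close>

lemma Ck_on_compose:
  fixes G :: "'a::euclidean_space \<Rightarrow> 'b::euclidean_space" and F :: "'b \<Rightarrow> 'c::real_normed_vector"
  assumes "open U" "Ck_on k G U" "Ck_on k F V" "G ` U \<subseteq> V"
  shows "Ck_on k (\<lambda>x. F (G x)) U"
  using assms(2,3)
proof (induction k arbitrary: F)
  case 0
  then show ?case
    using assms(4) by (auto intro: continuous_on_compose2)
next
  case (Suc k)
  show ?case
  proof (rule Ck_on_SucI[OF assms(1)])
    fix x assume "x \<in> U"
    then have G: "(G has_derivative frechet_derivative G (at x)) (at x)"
      and F: "(F has_derivative frechet_derivative F (at (G x))) (at (G x))"
      using Suc.prems assms(4) by (auto intro!: Ck_on_SucE)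
    have "(F \<circ> G has_derivative frechet_derivative F (at (G x)) \<circ> frechet_derivative G (at x)) (at x)"
      by (rule diff_chain_at[OF G F])
    moreover have "frechet_derivative F (at (G x)) \<circ> frechet_derivative G (at x)
        = (\<lambda>v. \<Sum>b\<in>Basis. (frechet_derivative G (at x) v \<bullet> b) *\<^sub>R frechet_derivative F (at (G x)) b)"
      unfolding o_def by (rule ext) (rule linear_euclidean_expansion[OF has_derivative_linear[OF F]])
    ultimately show "((\<lambda>x. F (G x)) has_derivative
        (\<lambda>v. \<Sum>b\<in>Basis. (frechet_derivative G (at x) v \<bullet> b) *\<^sub>R frechet_derivative F (at (G x)) b)) (at x)"
      by (simp add: o_def)
  next
    fix v
    show "Ck_on k (\<lambda>x. \<Sum>b\<in>Basis. (frechet_derivative G (at x) v \<bullet> b) *\<^sub>R frechet_derivative F (at (G x)) b) U"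
      using Suc.prems Ck_on_SucD
      by (intro Ck_on_sum Ck_on_scaleR Ck_on_inner assms(1) Suc.IH Ck_on_const) auto
  qed
qed

text \<open>The derivative of \<open>1/g\<close> contains \<open>1/g\<close> again, but needs it to
  one order less, so the induction closes.\<close>

lemma Ck_on_inverse:
  fixes g :: "'a::euclidean_space \<Rightarrow> real"
  assumes "open U" "Ck_on k g U" "\<And>x. x \<in> U \<Longrightarrow> g x \<noteq> 0"
  shows "Ck_on k (\<lambda>x. inverse (g x)) U"
  using assms(2)
proof (induction k)
  case 0
  then show ?case
    using assms(3) by (simp add: continuous_on_inverse)
next
  case (Suc k)
  show ?case
  proof (rule Ck_on_SucI[OF assms(1)])
    show "((\<lambda>x. inverse (g x)) has_derivative
        (\<lambda>v. (-1) * (inverse (g x) * frechet_derivative g (at x) v * inverse (g x)))) (at x)" if "x \<in> U" for x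
      using Deriv.has_derivative_inverse[OF assms(3)[OF that] Ck_on_SucE[OF Suc.prems that]] by simp
    show "Ck_on k (\<lambda>x. (-1) * (inverse (g x) * frechet_derivative g (at x) v * inverse (g x))) U" for v
      using Suc Ck_on_SucD by (intro Ck_on_mult assms(1) Ck_on_const Suc.IH) auto
  qed
qed

text \<open>Taking all orders at once avoids counting them: differentiation loses nothing
  here.\<close>

definition Cinf_on :: "('a::euclidean_space \<Rightarrow> 'b::real_normed_vector) \<Rightarrow> 'a set \<Rightarrow> bool" where
  "Cinf_on f U \<longleftrightarrow> (\<forall>k. Ck_on k f U)"

lemma Cinf_on_has_derivative:
  "Cinf_on f U \<Longrightarrow> x \<in> U \<Longrightarrow> (f has_derivative frechet_derivative f (at x)) (at x)"
  unfolding Cinf_on_def using Ck_on_SucE by blast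

lemma Cinf_on_frechet_derivative:
  "Cinf_on f U \<Longrightarrow> Cinf_on (\<lambda>x. frechet_derivative f (at x) v) U"
  unfolding Cinf_on_def using Ck_on.simps(2) by blast

lemma Cinf_on_continuous: "Cinf_on f U \<Longrightarrow> continuous_on U f"
  unfolding Cinf_on_def using Ck_on.simps(1) by blast

lemma Cinf_on_subset: "Cinf_on f U \<Longrightarrow> V \<subseteq> U \<Longrightarrow> Cinf_on f V"
  unfolding Cinf_on_def using Ck_on_subset by blast

lemma Cinf_on_const: "Cinf_on (\<lambda>x. c) U"
  unfolding Cinf_on_def using Ck_on_const by blast

lemma Cinf_on_bounded_linear: "bounded_linear L \<Longrightarrow> Cinf_on L U"
  unfolding Cinf_on_def using Ck_on_bounded_linear by blast

lemma Cinf_on_add: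
  "open U \<Longrightarrow> Cinf_on f U \<Longrightarrow> Cinf_on g U \<Longrightarrow> Cinf_on (\<lambda>x. f x + g x) U"
  unfolding Cinf_on_def using Ck_on_add by blast

lemma Cinf_on_sum:
  "open U \<Longrightarrow> finite I \<Longrightarrow> (\<And>i. i \<in> I \<Longrightarrow> Cinf_on (f i) U) \<Longrightarrow> Cinf_on (\<lambda>x. \<Sum>i\<in>I. f i x) U"
  unfolding Cinf_on_def using Ck_on_sum by blast

lemma (in bounded_bilinear) Cinf_on_bilinear:
  "open U \<Longrightarrow> Cinf_on f U \<Longrightarrow> Cinf_on g U \<Longrightarrow> Cinf_on (\<lambda>x. prod (f x) (g x)) U"
  unfolding Cinf_on_def using Ck_on_bilinear by blast

lemmas Cinf_on_scaleR = bounded_bilinear.Cinf_on_bilinear[OF bounded_bilinear_scaleR]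
lemmas Cinf_on_inner = bounded_bilinear.Cinf_on_bilinear[OF bounded_bilinear_inner]

lemma Cinf_on_inverse:
  fixes g :: "'a::euclidean_space \<Rightarrow> real"
  shows "open U \<Longrightarrow> Cinf_on g U \<Longrightarrow> (\<And>x. x \<in> U \<Longrightarrow> g x \<noteq> 0) \<Longrightarrow> Cinf_on (\<lambda>x. inverse (g x)) U"
  unfolding Cinf_on_def using Ck_on_inverse by blast

lemma Cinf_on_compose:
  fixes G :: "'a::euclidean_space \<Rightarrow> 'b::euclidean_space" and F :: "'b \<Rightarrow> 'c::real_normed_vector"
  shows "open U \<Longrightarrow> Cinf_on G U \<Longrightarrow> Cinf_on F V \<Longrightarrow> G ` U \<subseteq> V \<Longrightarrow> Cinf_on (\<lambda>x. F (G x)) U"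
  unfolding Cinf_on_def using Ck_on_compose by blast

lemma Cinf_on_directional_derivative:
  assumes "open U" "Cinf_on F U" "Cinf_on X U"
  shows "Cinf_on (\<lambda>x. \<Sum>b\<in>Basis. (X x \<bullet> b) *\<^sub>R frechet_derivative F (at x) b) U"
  by (intro Cinf_on_sum Cinf_on_scaleR Cinf_on_inner Cinf_on_frechet_derivative Cinf_on_const assms) auto

subsection \<open>Symmetry of the second derivative\<close>

text \<open>The mean value theorem is applied twice: along \<open>u\<close> to the difference of
  \<open>F\<close> and its translate by \<open>s v\<close>, then along \<open>v\<close> to the
  derivative in direction \<open>u\<close>. The bound on \<open>s\<close> keeps the parallelogram
  inside the ball. The second difference is symmetric in \<open>u\<close> and
  \<open>v\<close>.\<close>

lemma second_difference_mean_value: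
  fixes F :: "'a::euclidean_space \<Rightarrow> real"
  assumes F: "Cinf_on F (ball x r)" and s: "s > 0" "s * (norm u + norm v) < r"
  obtains y where "dist x y < r" and "F (x + s *\<^sub>R u + s *\<^sub>R v) - F (x + s *\<^sub>R u) - F (x + s *\<^sub>R v) + F x
     = s * s * frechet_derivative (\<lambda>y. frechet_derivative F (at y) u) (at y) v"
proof -
  let ?G = "\<lambda>y. frechet_derivative F (at y) u"
  have mem: "x + a *\<^sub>R u + b *\<^sub>R v \<in> ball x r" if "0 \<le> a" "a \<le> s" "0 \<le> b" "b \<le> s" for a b
  proof -
    have "norm (a *\<^sub>R u + b *\<^sub>R v) \<le> a * norm u + b * norm v"
      using that norm_triangle_ineq[of "a *\<^sub>R u" "b *\<^sub>R v"] by simp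
    also have "\<dots> \<le> s * norm u + s * norm v"
      using that by (intro add_mono mult_right_mono) auto
    also have "\<dots> < r"
      using s by (simp add: algebra_simps)
    finally show ?thesis
      using norm_minus_cancel[of "a *\<^sub>R u + b *\<^sub>R v"] by (simp add: dist_norm del: norm_minus_cancel)
  qed
  have DF: "((\<lambda>a. F (x + a *\<^sub>R u + b *\<^sub>R v)) has_real_derivative ?G (x + a *\<^sub>R u + b *\<^sub>R v)) (at a)"
    if "0 \<le> a" "a \<le> s" "0 \<le> b" "b \<le> s" for a b
  proof -
    have 1: "((\<lambda>a. x + a *\<^sub>R u + b *\<^sub>R v) has_derivative (\<lambda>h. h *\<^sub>R u)) (at a)"
      by (auto intro!: derivative_eq_intros)
    have 2: "(F has_derivative frechet_derivative F (at (x + a *\<^sub>R u + b *\<^sub>R v))) (at (x + a *\<^sub>R u + b *\<^sub>R v))"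
      using Cinf_on_has_derivative[OF F mem[OF that]] .
    show ?thesis
      using has_derivative_compose[OF 1 2]
      by (simp add: has_field_derivative_def linear_cmul[OF has_derivative_linear[OF 2]] mult_commute_abs)
  qed
  obtain a where a: "0 < a" "a < s"
    and a': "(F (x + s *\<^sub>R u + s *\<^sub>R v) - F (x + s *\<^sub>R u)) - (F (x + s *\<^sub>R v) - F x)
       = s * (?G (x + a *\<^sub>R u + s *\<^sub>R v) - ?G (x + a *\<^sub>R u))"
  proof -
    have "\<exists>a>0. a < s \<and> (F (x + s *\<^sub>R u + s *\<^sub>R v) - F (x + s *\<^sub>R u + 0 *\<^sub>R v))
        - (F (x + 0 *\<^sub>R u + s *\<^sub>R v) - F (x + 0 *\<^sub>R u + 0 *\<^sub>R v))
       = (s - 0) * (?G (x + a *\<^sub>R u + s *\<^sub>R v) - ?G (x + a *\<^sub>R u + 0 *\<^sub>R v))"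
      using s(1) by (intro MVT2 DERIV_diff DF) auto
    then show ?thesis
      using that by auto
  qed
  have DG: "((\<lambda>b. ?G (x + a *\<^sub>R u + b *\<^sub>R v)) has_real_derivative
      frechet_derivative ?G (at (x + a *\<^sub>R u + b *\<^sub>R v)) v) (at b)" if "0 \<le> b" "b \<le> s" for b
  proof -
    have 1: "((\<lambda>b. x + a *\<^sub>R u + b *\<^sub>R v) has_derivative (\<lambda>h. h *\<^sub>R v)) (at b)"
      by (auto intro!: derivative_eq_intros)
    have 2: "(?G has_derivative frechet_derivative ?G (at (x + a *\<^sub>R u + b *\<^sub>R v))) (at (x + a *\<^sub>R u + b *\<^sub>R v))"
      using Cinf_on_has_derivative[OF Cinf_on_frechet_derivative[OF F] mem] a that by simp
    show ?thesis
      using has_derivative_compose[OF 1 2]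
      by (simp add: has_field_derivative_def linear_cmul[OF has_derivative_linear[OF 2]] mult_commute_abs)
  qed
  have "\<exists>b>0. b < s \<and> ?G (x + a *\<^sub>R u + s *\<^sub>R v) - ?G (x + a *\<^sub>R u + 0 *\<^sub>R v)
      = (s - 0) * frechet_derivative ?G (at (x + a *\<^sub>R u + b *\<^sub>R v)) v"
    using s(1) by (intro MVT2 DG) auto
  then obtain b where b: "0 < b" "b < s"
    "?G (x + a *\<^sub>R u + s *\<^sub>R v) - ?G (x + a *\<^sub>R u) = s * frechet_derivative ?G (at (x + a *\<^sub>R u + b *\<^sub>R v)) v"
    by auto
  have "dist x (x + a *\<^sub>R u + b *\<^sub>R v) < r"
    using mem[of a b] a b by simp
  then show ?thesis
    using that a' b(3) by simp
qed

text \<open>Each mixed derivative, taken at some point near \<open>x\<close>, equals the same second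
  difference divided by \<open>s\<^sup>2\<close>; continuity moves both points to
  \<open>x\<close>.\<close>

lemma frechet_derivative_symmetric_real:
  fixes F :: "'a::euclidean_space \<Rightarrow> real"
  assumes "open U" "x \<in> U" "Cinf_on F U"
  shows "frechet_derivative (\<lambda>y. frechet_derivative F (at y) u) (at x) v
       = frechet_derivative (\<lambda>y. frechet_derivative F (at y) v) (at x) u"
proof -
  let ?A = "\<lambda>u v y. frechet_derivative (\<lambda>y. frechet_derivative F (at y) u) (at y) v"
  have cont: "isCont (?A u v) x" for u v
    using assms by (metis Cinf_on_continuous Cinf_on_frechet_derivative continuous_on_eq_continuous_at)
  have "\<bar>?A u v x - ?A v u x\<bar> \<le> e" if "e > 0" for e
  proof -
    have "\<exists>d>0. \<forall>y. dist x y < d \<longrightarrow> \<bar>?A u v y - ?A u v x\<bar> < e / 2" for u v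
      using cont[of u v] \<open>e > 0\<close> unfolding continuous_at_eps_delta
      by (metis dist_commute dist_real_def half_gt_zero)
    then obtain d1 d2 where d: "d1 > 0" "\<And>y. dist x y < d1 \<Longrightarrow> \<bar>?A u v y - ?A u v x\<bar> < e / 2"
      "d2 > 0" "\<And>y. dist x y < d2 \<Longrightarrow> \<bar>?A v u y - ?A v u x\<bar> < e / 2"
      by metis
    obtain d0 where d0: "d0 > 0" "ball x d0 \<subseteq> U"
      using assms by (meson openE)
    define r where "r = min d0 (min d1 d2)"
    \<comment> \<open>The summand 1 covers the case \<open>u = v = 0\<close> and makes the bound on
      \<open>s\<close> strict.\<close>
    define s where "s = r / (norm u + norm v + 1)"
    have r: "r > 0" "ball x r \<subseteq> U"
      using d d0 by (auto simp: r_def)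
    have F: "Cinf_on F (ball x r)"
      using assms(3) r(2) by (rule Cinf_on_subset)
    have s: "s > 0" "s * (norm u + norm v) < r"
      using r by (simp_all add: s_def field_simps add_pos_nonneg)
    obtain y where y: "dist x y < r" "F (x + s *\<^sub>R u + s *\<^sub>R v) - F (x + s *\<^sub>R u) - F (x + s *\<^sub>R v) + F x
       = s * s * ?A u v y"
      using second_difference_mean_value[OF F s] by blast
    obtain z where z: "dist x z < r" "F (x + s *\<^sub>R v + s *\<^sub>R u) - F (x + s *\<^sub>R v) - F (x + s *\<^sub>R u) + F x
       = s * s * ?A v u z"
      using second_difference_mean_value[OF F s(1), of v u] s(2) by (metis add.commute)
    have "s * s * ?A u v y = s * s * ?A v u z"
      using y(2) z(2) by (simp add: algebra_simps)
    then have "?A u v y = ?A v u z"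
      using s(1) by simp
    moreover have "\<bar>?A u v y - ?A u v x\<bar> < e / 2" "\<bar>?A v u z - ?A v u x\<bar> < e / 2"
      using d(2)[of y] d(4)[of z] y(1) z(1) by (simp_all add: r_def)
    ultimately show ?thesis
      by linarith
  qed
  then have "\<bar>?A u v x - ?A v u x\<bar> \<le> 0"
    by (rule field_le_epsilon) auto
  then show ?thesis
    by simp
qed

lemma frechet_derivative_symmetric:
  fixes F :: "'a::euclidean_space \<Rightarrow> 'b::euclidean_space"
  assumes "open U" "x \<in> U" "Cinf_on F U"
  shows "frechet_derivative (\<lambda>y. frechet_derivative F (at y) u) (at x) v
       = frechet_derivative (\<lambda>y. frechet_derivative F (at y) v) (at x) u"
proof (rule euclidean_eqI)
  fix b :: 'b assume "b \<in> Basis"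
  have inner: "frechet_derivative (\<lambda>y. G y \<bullet> b) (at y) w = frechet_derivative G (at y) w \<bullet> b"
    if "Cinf_on G U" "y \<in> U" for G y w
    using has_derivative_inner_left[OF Cinf_on_has_derivative[OF that], of b]
    by (simp add: frechet_derivative_eq)
  have "frechet_derivative (\<lambda>y. frechet_derivative F (at y) u) (at x) v \<bullet> b
      = frechet_derivative (\<lambda>y. frechet_derivative (\<lambda>y. F y \<bullet> b) (at y) u) (at x) v" for u v
  proof -
    have "((\<lambda>y. frechet_derivative F (at y) u \<bullet> b) has_derivative
        (\<lambda>w. frechet_derivative (\<lambda>y. frechet_derivative F (at y) u) (at x) w \<bullet> b)) (at x)"
      using assms by (intro has_derivative_inner_left Cinf_on_has_derivative[of _ U] Cinf_on_frechet_derivative)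
    then have "((\<lambda>y. frechet_derivative (\<lambda>y. F y \<bullet> b) (at y) u) has_derivative
        (\<lambda>w. frechet_derivative (\<lambda>y. frechet_derivative F (at y) u) (at x) w \<bullet> b)) (at x)"
      using assms(1,2) by (rule has_derivative_transform_within_open) (simp add: inner assms)
    then show ?thesis
      by (simp add: frechet_derivative_eq)
  qed
  moreover have "Cinf_on (\<lambda>y. F y \<bullet> b) U"
    using assms by (intro Cinf_on_inner Cinf_on_const)
  ultimately show "frechet_derivative (\<lambda>y. frechet_derivative F (at y) u) (at x) v \<bullet> b
      = frechet_derivative (\<lambda>y. frechet_derivative F (at y) v) (at x) u \<bullet> b"
    using frechet_derivative_symmetric_real[OF assms(1,2)] by metis
qed

section \<open>Smooth maps on subsets\<close>

lemma smooth_onI: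
  assumes "\<And>p. p \<in> A \<Longrightarrow> \<exists>U F. open U \<and> p \<in> U \<and> Cinf_on F U \<and> (\<forall>x\<in>A \<inter> U. F x = f x)"
  shows "smooth_on A f"
  using assms unfolding smooth_on_def Cinf_on_def by blast

lemma smooth_onE:
  assumes "smooth_on A f" "p \<in> A"
  obtains U F where "open U" "p \<in> U" "Cinf_on F U" "\<And>x. x \<in> A \<inter> U \<Longrightarrow> F x = f x"
proof -
  from assms(1)[unfolded smooth_on_def, rule_format, OF assms(2)]
  obtain U F where "open U \<and> p \<in> U \<and> (\<forall>k. Ck_on k F U) \<and> (\<forall>x\<in>A \<inter> U. F x = f x)"
    by (elim exE)
  then show ?thesis
    by (intro that[of U F]) (simp_all add: Cinf_on_def)
qed

lemma smooth_on_cong: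
  assumes "smooth_on A f" "\<And>x. x \<in> A \<Longrightarrow> f x = g x"
  shows "smooth_on A g"
proof (rule smooth_onI)
  fix p assume p: "p \<in> A"
  obtain U F where "open U" "p \<in> U" "Cinf_on F U" "\<And>x. x \<in> A \<inter> U \<Longrightarrow> F x = f x"
    using smooth_onE[OF assms(1) p] by blast
  then show "\<exists>U F. open U \<and> p \<in> U \<and> Cinf_on F U \<and> (\<forall>x\<in>A \<inter> U. F x = g x)"
    using assms(2) by (intro exI[of _ U] exI[of _ F]) simp
qed

lemma Cinf_on_imp_smooth_on: "open U \<Longrightarrow> Cinf_on f U \<Longrightarrow> A \<subseteq> U \<Longrightarrow> smooth_on A f"
  by (intro smooth_onI exI[of _ U] exI[of _ f]) auto

lemma smooth_on_const: "smooth_on A (\<lambda>x. c)"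
  using Cinf_on_imp_smooth_on[OF open_UNIV Cinf_on_const] by auto

lemma smooth_on_bounded_linear: "bounded_linear L \<Longrightarrow> smooth_on A L"
  using Cinf_on_imp_smooth_on[OF open_UNIV Cinf_on_bounded_linear] by auto

lemma smooth_on_ident: "smooth_on A (\<lambda>x. x)"
  by (rule smooth_on_bounded_linear[OF bounded_linear_ident])

lemma smooth_on_combine:
  fixes A :: "'a::euclidean_space set"
  assumes f: "smooth_on A f" and g: "smooth_on A g"
    and *: "\<And>(U :: 'a set) F G. open U \<Longrightarrow> Cinf_on F U \<Longrightarrow> Cinf_on G U \<Longrightarrow> Cinf_on (\<lambda>x. h (F x) (G x)) U"
  shows "smooth_on A (\<lambda>x. h (f x) (g x))"
proof (rule smooth_onI)
  fix p assume p: "p \<in> A"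
  obtain U F where U: "open U" "p \<in> U" "Cinf_on F U" "\<And>x. x \<in> A \<inter> U \<Longrightarrow> F x = f x"
    using smooth_onE[OF f p] by blast
  obtain V G where V: "open V" "p \<in> V" "Cinf_on G V" "\<And>x. x \<in> A \<inter> V \<Longrightarrow> G x = g x"
    using smooth_onE[OF g p] by blast
  have "Cinf_on (\<lambda>x. h (F x) (G x)) (U \<inter> V)"
    using U V by (intro *) (auto elim: Cinf_on_subset)
  then show "\<exists>U H. open U \<and> p \<in> U \<and> Cinf_on H U \<and> (\<forall>x\<in>A \<inter> U. H x = h (f x) (g x))"
    using U V by (intro exI[of _ "U \<inter> V"] exI[of _ "\<lambda>x. h (F x) (G x)"]) auto
qed

lemma smooth_on_add: "smooth_on A f \<Longrightarrow> smooth_on A g \<Longrightarrow> smooth_on A (\<lambda>x. f x + g x)"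
  by (rule smooth_on_combine) (auto intro: Cinf_on_add)

lemma smooth_on_scaleR: "smooth_on A f \<Longrightarrow> smooth_on A g \<Longrightarrow> smooth_on A (\<lambda>x. f x *\<^sub>R g x)"
  by (rule smooth_on_combine) (auto intro: Cinf_on_scaleR)

lemma smooth_on_inner: "smooth_on A f \<Longrightarrow> smooth_on A g \<Longrightarrow> smooth_on A (\<lambda>x. f x \<bullet> g x)"
  by (rule smooth_on_combine) (auto intro: Cinf_on_inner)

lemma smooth_on_diff: "smooth_on A f \<Longrightarrow> smooth_on A g \<Longrightarrow> smooth_on A (\<lambda>x. f x - g x)"
  using smooth_on_add[OF _ smooth_on_scaleR[OF smooth_on_const[of _ "-1"]]] by fastforce

lemma smooth_on_sum:
  "(\<And>i. i \<in> I \<Longrightarrow> smooth_on A (f i)) \<Longrightarrow> smooth_on A (\<lambda>x. \<Sum>i\<in>I. f i x)"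
  by (induction I rule: infinite_finite_induct) (auto simp: smooth_on_const intro: smooth_on_add)

lemma smooth_on_inverse:
  fixes f :: "'a::euclidean_space \<Rightarrow> real"
  assumes "smooth_on A f" "\<And>x. x \<in> A \<Longrightarrow> f x \<noteq> 0"
  shows "smooth_on A (\<lambda>x. inverse (f x))"
proof (rule smooth_onI)
  fix p assume p: "p \<in> A"
  obtain U F where U: "open U" "p \<in> U" "Cinf_on F U" "\<And>x. x \<in> A \<inter> U \<Longrightarrow> F x = f x"
    using smooth_onE[OF assms(1) p] by blast
  \<comment> \<open>The extension \<open>F\<close> may have zeros outside \<open>A\<close>; they are
    cut out of its domain.\<close>
  let ?V = "U \<inter> F -` (- {0})"
  have "open ?V"
    using U by (intro continuous_open_preimage Cinf_on_continuous) auto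
  moreover from this have "Cinf_on (\<lambda>x. inverse (F x)) ?V"
    using U by (intro Cinf_on_inverse) (auto elim: Cinf_on_subset)
  ultimately show "\<exists>U H. open U \<and> p \<in> U \<and> Cinf_on H U \<and> (\<forall>x\<in>A \<inter> U. H x = inverse (f x))"
    using U p assms(2) by (intro exI[of _ ?V] exI[of _ "\<lambda>x. inverse (F x)"]) auto
qed

subsection \<open>Orthogonal projections onto subspaces\<close>

text \<open>Pythagoras: a residual orthogonal to the generators is orthogonal to their span, so no
  other point of the span is closer.\<close>

lemma closest_point_span_eqI:
  fixes S :: "'a::euclidean_space set"
  assumes "w \<in> span S" and "\<And>v. v \<in> S \<Longrightarrow> (a - w) \<bullet> v = 0"
  shows "closest_point (span S) a = w"
proof -
  have orth: "(a - w) \<bullet> v = 0" if "v \<in> span S" for v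
    using that assms(2) orthogonal_to_span[of v S "a - w"] by (simp add: orthogonal_def)
  have "dist a w \<le> dist a z" if "z \<in> span S" for z
  proof -
    have "(a - w) \<bullet> (w - z) = 0"
      using orth assms(1) that by (simp add: span_diff)
    then have "(norm (a - z))\<^sup>2 = (norm (a - w))\<^sup>2 + (norm (w - z))\<^sup>2"
      by (simp add: power2_norm_eq_inner algebra_simps inner_commute)
    then show ?thesis
      by (simp add: dist_norm power2_le_imp_le)
  qed
  then show ?thesis
    using assms(1) closest_point_unique[of "span S" w a]
    by (simp add: closed_subspace subspace_imp_convex)
qed

lemma closest_point_subspace_eqI:
  fixes T :: "'a::euclidean_space set"
  assumes "subspace T" "w \<in> T" "\<And>v. v \<in> T \<Longrightarrow> (a - w) \<bullet> v = 0"
  shows "closest_point T a = w"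
  using closest_point_span_eqI[of w T a] assms by (simp add: span_eq_iff[THEN iffD2])

lemma
  fixes T :: "'a::euclidean_space set"
  assumes "subspace T"
  shows closest_point_in_subspace: "closest_point T a \<in> T"
    and closest_point_subspace_orthogonal: "v \<in> T \<Longrightarrow> (a - closest_point T a) \<bullet> v = 0"
proof -
  obtain y z where "y \<in> span T" "\<And>w. w \<in> span T \<Longrightarrow> orthogonal z w" "a = y + z"
    using orthogonal_subspace_decomp_exists[of T a] by metis
  then have y: "y \<in> T" "\<And>w. w \<in> T \<Longrightarrow> (a - y) \<bullet> w = 0"
    using assms by (auto simp: orthogonal_def span_eq_iff[THEN iffD2])
  then have "closest_point T a = y"
    using assms by (intro closest_point_subspace_eqI)
  with y show "closest_point T a \<in> T" "v \<in> T \<Longrightarrow> (a - closest_point T a) \<bullet> v = 0"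
    by auto
qed

lemma linear_closest_point_subspace:
  fixes T :: "'a::euclidean_space set"
  assumes "subspace T"
  shows "linear (closest_point T)"
proof
  fix a b :: 'a and r :: real
  note * = closest_point_in_subspace[OF assms] closest_point_subspace_orthogonal[OF assms]
  show "closest_point T (a + b) = closest_point T a + closest_point T b"
    using *(1)[of a] *(1)[of b] *(2)[of _ a] *(2)[of _ b]
    by (intro closest_point_subspace_eqI assms subspace_add) (simp_all add: inner_diff_left inner_add_left)
  show "closest_point T (r *\<^sub>R a) = r *\<^sub>R closest_point T a"
    using *(1)[of a] *(2)[of _ a]
    by (intro closest_point_subspace_eqI assms subspace_scale) (simp_all add: inner_diff_left)
qed

text \<open>Gram--Schmidt orthogonalisation without normalisation, so that no square roots are
  needed.\<close>

lemma smooth_on_closest_point_span: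
  fixes v :: "'i \<Rightarrow> 'a::euclidean_space \<Rightarrow> 'a"
  assumes "finite I" and "\<And>i. i \<in> I \<Longrightarrow> smooth_on A (v i)"
    and "\<And>q i. q \<in> A \<Longrightarrow> i \<in> I \<Longrightarrow> v i q \<notin> span ((\<lambda>j. v j q) ` (I - {i}))"
    and "smooth_on A g"
  shows "smooth_on A (\<lambda>q. closest_point (span ((\<lambda>j. v j q) ` I)) (g q))"
  using assms
proof (induction I arbitrary: g rule: finite_induct)
  case empty
  have "closest_point {0} a = 0" for a :: 'a
    by (rule closest_point_subspace_eqI) auto
  then show ?case
    by (simp add: smooth_on_const)
next
  case (insert i I)
  let ?P = "\<lambda>q. closest_point (span ((\<lambda>j. v j q) ` I))"
  have indep: "v i q \<notin> span ((\<lambda>j. v j q) ` I)" if "q \<in> A" for q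
    using insert.prems(2)[OF that, of i] insert.hyps(2) by auto
  have "v k q \<notin> span ((\<lambda>j. v j q) ` (I - {k}))" if "q \<in> A" "k \<in> I" for q k
    using insert.prems(2)[OF that(1), of k] that(2) insert.hyps(2)
      span_mono[of "(\<lambda>j. v j q) ` (I - {k})" "(\<lambda>j. v j q) ` (insert i I - {k})"] by blast
  then have P: "smooth_on A (\<lambda>q. ?P q (h q))" if "smooth_on A h" for h
    using insert.prems(1) that by (intro insert.IH) auto
  \<comment> \<open>The part of the new vector orthogonal to the earlier span. Independence keeps it
    away from zero, so dividing by its squared length stays smooth.\<close>
  define w where "w = (\<lambda>q. v i q - ?P q (v i q))"
  have w: "smooth_on A w"
    unfolding w_def using insert.prems(1) by (intro smooth_on_diff P) auto
  have w0: "w q \<noteq> 0" if "q \<in> A" for q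
    using closest_point_in_subspace[of "span ((\<lambda>j. v j q) ` I)" "v i q"] indep[OF that]
    by (auto simp: w_def)
  have "smooth_on A (\<lambda>q. ?P q (g q) + (inverse (w q \<bullet> w q) * (g q \<bullet> w q)) *\<^sub>R w q)"
    using w w0 insert.prems(3)
    by (intro smooth_on_add P smooth_on_scaleR[OF smooth_on_scaleR[where g="\<lambda>q. g q \<bullet> w q",
      unfolded real_scaleR_def]]) (auto intro!: smooth_on_inverse smooth_on_inner)
  moreover have "?P q (g q) + (inverse (w q \<bullet> w q) * (g q \<bullet> w q)) *\<^sub>R w q
     = closest_point (span ((\<lambda>j. v j q) ` insert i I)) (g q)" if "q \<in> A" for q
  proof (rule sym, rule closest_point_span_eqI)
    let ?S = "span ((\<lambda>j. v j q) ` I)" and ?S' = "span ((\<lambda>j. v j q) ` insert i I)"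
    have sub: "?S \<subseteq> ?S'"
      by (intro span_mono) auto
    note proj = closest_point_in_subspace[OF subspace_span] closest_point_subspace_orthogonal[OF subspace_span]
    have "w q \<in> ?S'"
      unfolding w_def using subsetD[OF sub proj(1)] by (intro span_diff) (auto intro: span_base)
    then show "?P q (g q) + (inverse (w q \<bullet> w q) * (g q \<bullet> w q)) *\<^sub>R w q \<in> ?S'"
      using sub proj(1) by (intro span_add span_scale) auto
    have wS: "w q \<bullet> s = 0" if "s \<in> ?S" for s
      unfolding w_def using that by (rule proj(2))
    fix u assume u: "u \<in> (\<lambda>j. v j q) ` insert i I"
    show "(g q - (?P q (g q) + (inverse (w q \<bullet> w q) * (g q \<bullet> w q)) *\<^sub>R w q)) \<bullet> u = 0"
    proof (cases "u \<in> ?S")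
      case True
      then show ?thesis
        using proj(2)[of u _ "g q"] wS[of u] by (simp add: inner_diff_left inner_add_left)
    next
      case False
      then have "u = w q + ?P q (v i q)"
        using u by (auto simp: w_def intro: span_base)
      moreover have "w q \<bullet> ?P q (v i q) = 0" "?P q (g q) \<bullet> w q = 0"
        "g q \<bullet> ?P q (v i q) = ?P q (g q) \<bullet> ?P q (v i q)"
        using wS proj(1) proj(2)[of "?P q (v i q)" _ "g q"] by (auto simp: inner_diff_left inner_commute[of _ "w q"])
      moreover have "w q \<bullet> w q \<noteq> 0"
        using w0[OF \<open>q \<in> A\<close>] by simp
      ultimately show ?thesis
        by (simp add: inner_diff_left inner_add_left inner_add_right)
    qed
  qed
  ultimately show ?case
    by (rule smooth_on_cong)
qed

section \<open>Smooth retractions\<close>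

lemma line_in_open:
  fixes u e :: "'a::real_normed_vector"
  assumes "open U" "u \<in> U"
  obtains \<epsilon> where "\<epsilon> > 0" "\<And>t. \<bar>t\<bar> < \<epsilon> \<Longrightarrow> u + t *\<^sub>R e \<in> U"
proof -
  have "open ((\<lambda>t. u + t *\<^sub>R e) -` U)"
    using assms(1) by (intro open_vimage continuous_intros)
  moreover have "0 \<in> (\<lambda>t. u + t *\<^sub>R e) -` U"
    using assms(2) by simp
  ultimately obtain \<epsilon> where "\<epsilon> > 0" "ball 0 \<epsilon> \<subseteq> (\<lambda>t. u + t *\<^sub>R e) -` U"
    by (meson openE)
  then show ?thesis
    using that[of \<epsilon>] by (auto simp: subset_eq)
qed

lemma has_vector_derivative_along_line:
  assumes "(f has_derivative D) (at u)"
  shows "((\<lambda>t. f (u + t *\<^sub>R e)) has_vector_derivative D e) (at 0)"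
proof -
  have "((\<lambda>t. u + t *\<^sub>R e) has_derivative (\<lambda>t. t *\<^sub>R e)) (at 0)"
    by (auto intro!: derivative_eq_intros)
  from has_derivative_compose[OF this, of f D] assms
  show ?thesis
    by (simp add: has_vector_derivative_def linear_cmul[OF has_derivative_linear[OF assms]])
qed

lemma tangent_spaceE:
  assumes "v \<in> tangent_space M p"
  obtains \<gamma> \<epsilon> where "\<epsilon> > 0" "\<gamma> 0 = p" "\<And>t. \<bar>t\<bar> < \<epsilon> \<Longrightarrow> \<gamma> t \<in> M"
    "(\<gamma> has_vector_derivative v) (at (0::real))"
proof -
  from assms obtain \<gamma> \<epsilon> where "\<epsilon> > 0 \<and> \<gamma> 0 = p \<and> (\<forall>t. \<bar>t\<bar> < \<epsilon> \<longrightarrow> \<gamma> t \<in> M) \<and>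
     (\<gamma> has_vector_derivative v) (at (0::real))"
    unfolding tangent_space_def mem_Collect_eq by (elim exE)
  then show ?thesis
    by (intro that[of \<epsilon> \<gamma>]) auto
qed

text \<open>Near 0 a curve in \<open>M\<close> through \<open>p\<close> is fixed by
  \<open>\<rho>\<close>, so \<open>D\<close> fixes its velocity; conversely \<open>\<rho>\<close>
  maps the line \<open>p + t w\<close> to a curve in \<open>M\<close> with velocity
  \<open>D w\<close>. In particular the velocities form a linear subspace, which their definition
  does not show.\<close>

lemma tangent_space_retraction:
  assumes U: "open U" "p \<in> U" "p \<in> M" and \<rho>: "(\<rho> has_derivative D) (at p)" "\<rho> ` U \<subseteq> M"
    and id: "\<And>x. x \<in> M \<inter> U \<Longrightarrow> \<rho> x = x"
  shows "tangent_space M p = range D"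
proof -
  have *: "D v = v" if v: "v \<in> tangent_space M p" for v
  proof -
    obtain \<gamma> \<epsilon> where \<gamma>: "\<epsilon> > 0" "\<gamma> 0 = p" "\<And>t. \<bar>t\<bar> < \<epsilon> \<Longrightarrow> \<gamma> t \<in> M"
      "(\<gamma> has_vector_derivative v) (at (0::real))"
      using v by (rule tangent_spaceE) blast
    have "(\<gamma> has_derivative (\<lambda>t. t *\<^sub>R v)) (at 0)"
      using \<gamma>(4) by (simp add: has_vector_derivative_def)
    from has_derivative_compose[OF this, of \<rho> D]
    have "((\<lambda>t. \<rho> (\<gamma> t)) has_vector_derivative D v) (at 0)"
      using \<rho>(1) by (simp add: \<gamma>(2) has_vector_derivative_def linear_cmul[OF has_derivative_linear[OF \<rho>(1)]])
    moreover have "((\<lambda>t. \<rho> (\<gamma> t)) has_vector_derivative v) (at 0)"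
    proof -
      have "isCont \<gamma> 0"
        using \<gamma>(4) has_vector_derivative_continuous by blast
      then have "\<forall>\<^sub>F t in at 0. \<gamma> t \<in> U"
        using U(1,2) \<gamma>(2) by (auto simp: isCont_def intro: topological_tendstoD)
      moreover have "\<forall>\<^sub>F t in at (0::real). \<bar>t\<bar> < \<epsilon>"
        using \<gamma>(1) by (auto simp: eventually_at intro!: exI[of _ \<epsilon>])
      ultimately have "\<forall>\<^sub>F t in at 0. \<gamma> t = \<rho> (\<gamma> t)"
        by eventually_elim (use \<gamma>(3) id in auto)
      moreover have "\<gamma> 0 = \<rho> (\<gamma> 0)"
        using U id \<gamma>(2) by auto
      ultimately show ?thesis
        using \<gamma>(4) unfolding has_vector_derivative_def
        by (auto intro: has_derivative_transform_eventually)
    qed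
    ultimately show ?thesis
      by (rule vector_derivative_unique_at)
  qed
  show ?thesis
  proof
    show "tangent_space M p \<subseteq> range D"
      using * by (metis rangeI subsetI)
    show "range D \<subseteq> tangent_space M p"
    proof
      fix v assume "v \<in> range D"
      then obtain w where w: "v = D w"
        by blast
      obtain \<epsilon> where "\<epsilon> > 0" "\<And>t. \<bar>t\<bar> < \<epsilon> \<Longrightarrow> p + t *\<^sub>R w \<in> U"
        using line_in_open[OF U(1,2)] by blast
      then show "v \<in> tangent_space M p"
        unfolding tangent_space_def using \<rho>(2) id U has_vector_derivative_along_line[OF \<rho>(1)] w
        by (intro CollectI exI[of _ "\<lambda>t. \<rho> (p + t *\<^sub>R w)"] exI[of _ \<epsilon>]) auto
    qed
  qed
qed

text \<open>The retraction is \<open>\<Psi> \<circ> \<pi> \<circ> \<Theta>\<close>: extended inverse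
  chart, projection onto \<open>E\<close>, extended chart. The projection is there because
  \<open>\<Theta>\<close> may leave \<open>E\<close> off \<open>M\<close>, whereas
  \<open>\<Psi>\<close> is known to land in \<open>M\<close> only on the chart domain inside
  \<open>E\<close>.\<close>

lemma submanifold_local_retraction:
  fixes M :: "'a::euclidean_space set"
  assumes "submanifold m M" "p \<in> M"
  obtains U \<rho>
  where "open U" "p \<in> U" "Cinf_on \<rho> U" "\<rho> ` U \<subseteq> M" "\<And>x. x \<in> M \<inter> U \<Longrightarrow> \<rho> x = x"
    and "\<And>a. smooth_on (M \<inter> U) (tfield M a)" and "dim (tangent_space M p) = m"
proof -
  obtain W and E :: "'a set" and U0 \<psi> \<theta> where
    W: "open W" "p \<in> W" and E: "subspace E" "dim E = m" "openin (top_of_set E) U0" and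
    hom: "homeomorphism U0 (M \<inter> W) \<psi> \<theta>" and smooth: "smooth_on U0 \<psi>" "smooth_on (M \<inter> W) \<theta>"
    using assms unfolding submanifold_def by meson
  have \<theta>\<psi>: "\<theta> (\<psi> u) = u" "\<psi> u \<in> M \<inter> W" if "u \<in> U0" for u
    using hom that by (auto simp: homeomorphism_def)
  have \<psi>\<theta>: "\<psi> (\<theta> x) = x" "\<theta> x \<in> U0" if "x \<in> M \<inter> W" for x
    using hom that by (auto simp: homeomorphism_def)
  obtain V \<Psi> where V: "open V" "\<theta> p \<in> V" "Cinf_on \<Psi> V" "\<And>x. x \<in> U0 \<inter> V \<Longrightarrow> \<Psi> x = \<psi> x"
    using smooth_onE[OF smooth(1), of "\<theta> p"] \<psi>\<theta>(2) W(2) assms(2) by blast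
  obtain V' \<Theta> where V': "open V'" "p \<in> V'" "Cinf_on \<Theta> V'" "\<And>x. x \<in> M \<inter> W \<inter> V' \<Longrightarrow> \<Theta> x = \<theta> x"
    using smooth_onE[OF smooth(2), of p] W(2) assms(2) by blast
  obtain O' where O: "open O'" "U0 = E \<inter> O'"
    using E(3) by (auto simp: openin_open)
  define \<pi> where "\<pi> = closest_point E"
  have \<pi>: "linear \<pi>" "\<And>x. \<pi> x \<in> E" "\<And>x. x \<in> E \<Longrightarrow> \<pi> x = x"
    unfolding \<pi>_def using linear_closest_point_subspace[OF E(1)] closest_point_in_subspace[OF E(1)]
    by (auto intro: closest_point_self)
  have b\<pi>: "bounded_linear \<pi>"
    using \<pi>(1) linear_conv_bounded_linear by blast
  have C\<pi>: "Cinf_on (\<lambda>x. \<pi> (\<Theta> x)) V'"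
    by (rule Cinf_on_compose[OF V'(1,3) Cinf_on_bounded_linear[OF b\<pi>, of UNIV]]) simp
  \<comment> \<open>On \<open>U\<close> the point \<open>\<pi> (\<Theta> x)\<close> lies in
    \<open>E\<close>, \<open>O'\<close> and \<open>V\<close>, hence in the part of the chart domain
    where \<open>\<Psi>\<close> and \<open>\<psi>\<close> agree.\<close>
  define U where "U = (V' \<inter> W) \<inter> (\<lambda>x. \<pi> (\<Theta> x)) -` (V \<inter> O')"
  define \<rho> where "\<rho> = (\<lambda>x. \<Psi> (\<pi> (\<Theta> x)))"
  have oU: "open U"
    unfolding U_def using W(1) V(1) V'(1) O(1) C\<pi>
    by (intro continuous_open_preimage Cinf_on_continuous) (auto elim: Cinf_on_subset)
  have UV: "U \<subseteq> V'" "(\<lambda>x. \<pi> (\<Theta> x)) ` U \<subseteq> V"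
    by (auto simp: U_def)
  have on_M: "\<Theta> q = \<theta> q" "\<theta> q \<in> U0" "\<theta> q \<in> E" "\<pi> (\<Theta> q) = \<theta> q" "\<theta> q \<in> V" "q \<in> M \<inter> W" "q \<in> V'"
    if "q \<in> M \<inter> U" for q
  proof -
    show *: "\<Theta> q = \<theta> q" "\<theta> q \<in> U0" "q \<in> M \<inter> W" "q \<in> V'"
      using that V'(4) \<psi>\<theta>(2) by (auto simp: U_def)
    then show "\<theta> q \<in> E" "\<pi> (\<Theta> q) = \<theta> q"
      using O(2) \<pi>(3) by auto
    then show "\<theta> q \<in> V"
      using that by (auto simp: U_def)
  qed
  have pU: "p \<in> U"
    using W(2) V(2) V'(2) V'(4)[of p] O(2) \<psi>\<theta>(2)[of p] \<pi>(3) assms(2) by (auto simp: U_def)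
  have C\<rho>: "Cinf_on \<rho> U"
    unfolding \<rho>_def by (rule Cinf_on_compose[OF oU Cinf_on_subset[OF C\<pi> UV(1)] V(3) UV(2)])
  have \<rho>M: "\<rho> ` U \<subseteq> M"
  proof
    fix y assume "y \<in> \<rho> ` U"
    then obtain x where "x \<in> U" "y = \<Psi> (\<pi> (\<Theta> x))"
      by (auto simp: \<rho>_def)
    moreover from this have "\<pi> (\<Theta> x) \<in> U0 \<inter> V"
      using O(2) \<pi>(2) by (auto simp: U_def)
    ultimately show "y \<in> M"
      using V(4) \<theta>\<psi>(2) by auto
  qed
  have \<rho>id: "\<rho> x = x" if "x \<in> M \<inter> U" for x
    using on_M[OF that] V(4)[of "\<theta> x"] \<psi>\<theta>(1)[of x] by (simp add: \<rho>_def)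
  obtain I where I: "I \<subseteq> E" "independent I" "E \<subseteq> span I" "card I = dim E"
    using basis_exists[of E] by blast
  have spanI: "span I = E"
    using I(1,3) E(1) span_minimal by blast
  \<comment> \<open>The differential of the chart maps a basis of \<open>E\<close> to a tangent
    frame; evaluated at \<open>\<pi> (\<Theta> q)\<close>, the frame is smooth on an open set of the
    ambient space.\<close>
  define L where "L = (\<lambda>q. frechet_derivative \<Psi> (at (\<pi> (\<Theta> q))))"
  have frame: "tangent_space M q = L q ` E" "inj_on (L q) E" "linear (L q)" if q: "q \<in> M \<inter> U" for q
  proof -
    have D\<Psi>: "(\<Psi> has_derivative L q) (at (\<theta> q))"
      using Cinf_on_has_derivative[OF V(3) on_M(5)[OF q]] on_M(4)[OF q] by (simp add: L_def)
    then show linL: "linear (L q)"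
      by (rule has_derivative_linear)
    have \<Psi>q: "\<Psi> (\<theta> q) = q"
      using \<rho>id[OF q] on_M(4)[OF q] by (simp add: \<rho>_def)
    have D\<Theta>: "(\<Theta> has_derivative frechet_derivative \<Theta> (at q)) (at q)"
      by (rule Cinf_on_has_derivative[OF V'(3) on_M(7)[OF q]])
    have curve: "\<exists>\<epsilon>>0. \<forall>t. \<bar>t\<bar> < \<epsilon> \<longrightarrow> \<theta> q + t *\<^sub>R e \<in> U0 \<inter> V \<and> \<Psi> (\<theta> q + t *\<^sub>R e) \<in> V'"
      if "e \<in> E" for e
    proof -
      have "open (V \<inter> \<Psi> -` V')"
        using V V' by (intro continuous_open_preimage Cinf_on_continuous)
      then have "open (O' \<inter> (V \<inter> \<Psi> -` V'))"
        using O(1) by auto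
      moreover have "\<theta> q \<in> O' \<inter> (V \<inter> \<Psi> -` V')"
        using on_M[OF q] O(2) \<Psi>q by auto
      ultimately obtain \<epsilon> where "\<epsilon> > 0" "\<And>t. \<bar>t\<bar> < \<epsilon> \<Longrightarrow> \<theta> q + t *\<^sub>R e \<in> O' \<inter> (V \<inter> \<Psi> -` V')"
        using line_in_open by blast
      moreover have "\<theta> q + t *\<^sub>R e \<in> E" for t
        using E(1) on_M(3)[OF q] that by (simp add: subspace_add subspace_scale)
      ultimately show ?thesis
        using O(2) by (intro exI[of _ \<epsilon>]) auto
    qed
    \<comment> \<open>\<open>\<Theta> \<circ> \<Psi>\<close> is the identity on \<open>E\<close>
      near \<open>\<theta> q\<close>, so the chart differential is injective on \<open>E\<close>.
      This gives the independence of the frame and the dimension \<open>m\<close>.\<close>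
    have left_inv: "frechet_derivative \<Theta> (at q) (L q e) = e" if "e \<in> E" for e
    proof -
      obtain \<epsilon> where \<epsilon>: "\<epsilon> > 0"
        "\<And>t. \<bar>t\<bar> < \<epsilon> \<Longrightarrow> \<theta> q + t *\<^sub>R e \<in> U0 \<inter> V \<and> \<Psi> (\<theta> q + t *\<^sub>R e) \<in> V'"
        using curve[OF \<open>e \<in> E\<close>] by blast
      have "(\<Theta> \<circ> \<Psi> has_derivative frechet_derivative \<Theta> (at q) \<circ> L q) (at (\<theta> q))"
        using D\<Theta> by (intro diff_chain_at[OF D\<Psi>]) (simp add: \<Psi>q)
      from has_vector_derivative_along_line[OF this, of e]
      have "((\<lambda>t. \<Theta> (\<Psi> (\<theta> q + t *\<^sub>R e))) has_vector_derivative frechet_derivative \<Theta> (at q) (L q e)) (at 0)"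
        by simp
      moreover have "((\<lambda>t. \<Theta> (\<Psi> (\<theta> q + t *\<^sub>R e))) has_vector_derivative e) (at 0)"
      proof -
        have "((\<lambda>t. \<theta> q + t *\<^sub>R e) has_vector_derivative e) (at 0)"
          by (auto intro!: derivative_eq_intros)
        then show ?thesis
        proof (rule has_vector_derivative_transform_within_open[of _ _ _ "{-\<epsilon><..<\<epsilon>}"])
          fix t assume "t \<in> {-\<epsilon><..<\<epsilon>}"
          then have *: "\<theta> q + t *\<^sub>R e \<in> U0 \<inter> V" "\<Psi> (\<theta> q + t *\<^sub>R e) \<in> V'"
            using \<epsilon>(2)[of t] by auto
          then show "\<theta> q + t *\<^sub>R e = \<Theta> (\<Psi> (\<theta> q + t *\<^sub>R e))"
            using V(4) V'(4) \<theta>\<psi> by auto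
        qed (use \<epsilon>(1) in auto)
      qed
      ultimately show ?thesis
        by (rule vector_derivative_unique_at)
    qed
    then show "inj_on (L q) E"
      by (metis inj_on_inverseI)
    show "tangent_space M q = L q ` E"
    proof
      have "(\<pi> \<circ> \<Theta> has_derivative \<pi> \<circ> frechet_derivative \<Theta> (at q)) (at q)"
        by (rule diff_chain_at[OF D\<Theta> bounded_linear_imp_has_derivative[OF b\<pi>]])
      moreover have "(\<Psi> has_derivative L q) (at ((\<pi> \<circ> \<Theta>) q))"
        using D\<Psi> on_M(4)[OF q] by simp
      ultimately have "(\<Psi> \<circ> (\<pi> \<circ> \<Theta>) has_derivative L q \<circ> (\<pi> \<circ> frechet_derivative \<Theta> (at q))) (at q)"
        by (rule diff_chain_at)
      then have D\<rho>: "(\<rho> has_derivative (\<lambda>v. L q (\<pi> (frechet_derivative \<Theta> (at q) v)))) (at q)"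
        by (simp add: \<rho>_def o_def)
      have "q \<in> U" "q \<in> M"
        using q by auto
      from tangent_space_retraction[OF oU this D\<rho> \<rho>M \<rho>id]
      show "tangent_space M q \<subseteq> L q ` E"
        using \<pi>(2) by auto
      show "L q ` E \<subseteq> tangent_space M q"
      proof
        fix x assume "x \<in> L q ` E"
        then obtain e where e: "e \<in> E" "x = L q e"
          by blast
        obtain \<epsilon> where "\<epsilon> > 0" "\<And>t. \<bar>t\<bar> < \<epsilon> \<Longrightarrow> \<theta> q + t *\<^sub>R e \<in> U0 \<inter> V"
          using curve[OF e(1)] by blast
        moreover from this(2) have "\<Psi> (\<theta> q + t *\<^sub>R e) \<in> M" if "\<bar>t\<bar> < \<epsilon>" for t
          using V(4) \<theta>\<psi>(2) that by (metis IntD1)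
        ultimately show "x \<in> tangent_space M q"
          unfolding tangent_space_def e(2) using has_vector_derivative_along_line[OF D\<Psi>] \<Psi>q
          by (intro CollectI exI[of _ "\<lambda>t. \<Psi> (\<theta> q + t *\<^sub>R e)"] exI[of _ \<epsilon>]) auto
      qed
    qed
  qed
  have finI: "finite I"
    using I(2) by (rule independent_imp_finite)
  have smL: "smooth_on (M \<inter> U) (\<lambda>q. L q i)" for i
    unfolding L_def
    by (rule Cinf_on_imp_smooth_on[OF oU Cinf_on_compose[OF oU Cinf_on_subset[OF C\<pi> UV(1)]
          Cinf_on_frechet_derivative[OF V(3)] UV(2)]]) auto
  have indep: "L q i \<notin> span ((\<lambda>j. L q j) ` (I - {i}))" if q: "q \<in> M \<inter> U" and i: "i \<in> I" for q i
  proof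
    assume "L q i \<in> span ((\<lambda>j. L q j) ` (I - {i}))"
    then obtain j where "j \<in> span (I - {i})" "L q i = L q j"
      using span_linear_image[OF frame(3)[OF q], of "I - {i}"] by auto
    moreover from this(1) have "j \<in> E"
      using span_mono[of "I - {i}" I] spanI by auto
    ultimately have "i \<in> span (I - {i})"
      using frame(2)[OF q] i I(1) by (metis inj_onD subsetD)
    then show False
      using I(2) i by (auto simp: dependent_def)
  qed
  have tangent: "tangent_space M q = span ((\<lambda>j. L q j) ` I)" if q: "q \<in> M \<inter> U" for q
    using frame[OF q] spanI span_linear_image[of "L q" I] by simp
  show thesis
  proof (rule that[OF oU pU C\<rho> \<rho>M \<rho>id])
    show "smooth_on (M \<inter> U) (tfield M a)" for a
      using smooth_on_closest_point_span[OF finI smL indep smooth_on_const]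
      by (rule smooth_on_cong) (simp_all add: tang_def tangent)
    have "p \<in> M \<inter> U"
      using pU assms(2) by simp
    then show "dim (tangent_space M p) = m"
      using frame[of p] E dim_image_eq[of "L p" E] by (simp add: span_eq_iff[THEN iffD2])
  qed
qed

section \<open>Tangential derivatives\<close>

lemma mderivI:
  assumes "(f has_derivative D) (at p within M)" "v \<in> tangent_space M p"
  shows "mderiv M f p v = D v"
  using assms(2) by (rule tangent_spaceE) (rule mderiv_along_curve(1)[OF assms(1)])

lemma mderiv_cong:
  assumes "p \<in> M" "\<And>x. x \<in> M \<Longrightarrow> f x = g x"
  shows "mderiv M f p = mderiv M g p"
proof -
  have "(f has_derivative D) (at p within M) \<longleftrightarrow> (g has_derivative D) (at p within M)" for D
    using assms by (metis has_derivative_transform)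
  then show ?thesis
    unfolding mderiv_def frechet_derivative_def by simp
qed

lemma has_derivative_transform_on_open:
  assumes "(F has_derivative D) (at p within M)" "open U" "p \<in> U" "p \<in> M"
    and "\<And>x. x \<in> M \<inter> U \<Longrightarrow> F x = f x"
  shows "(f has_derivative D) (at p within M)"
proof -
  obtain d where "d > 0" "ball p d \<subseteq> U"
    using assms(2,3) by (meson openE)
  then show ?thesis
    using assms by (intro has_derivative_transform_within[OF assms(1), of d f]) (auto simp: dist_commute subset_eq)
qed

text \<open>What the intrinsic calculus needs of a submanifold: local smooth retractions and a
  smooth tangential projection. Charts do not appear from here on.\<close>

locale regular_subset =
  fixes M :: "'a::euclidean_space set"
  assumes retraction: "p \<in> M \<Longrightarrow> \<exists>U \<rho>. open U \<and> p \<in> U \<and> Cinf_on \<rho> U \<and> \<rho> ` U \<subseteq> M \<and> (\<forall>x\<in>M \<inter> U. \<rho> x = x)"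
    and smooth_tang: "smooth_on M (tfield M a)"

lemma submanifold_regular_subset:
  assumes "submanifold m M"
  shows "regular_subset M"
proof
  show "\<exists>U \<rho>. open U \<and> p \<in> U \<and> Cinf_on \<rho> U \<and> \<rho> ` U \<subseteq> M \<and> (\<forall>x\<in>M \<inter> U. \<rho> x = x)" if "p \<in> M" for p
    by (rule submanifold_local_retraction[OF assms that]) blast
  show "smooth_on M (tfield M a)" for a
  proof (rule smooth_onI)
    fix p assume "p \<in> M"
    obtain U where "open U" "p \<in> U" "\<And>a. smooth_on (M \<inter> U) (tfield M a)"
      by (rule submanifold_local_retraction[OF assms \<open>p \<in> M\<close>]) blast
    moreover from this obtain V F where "open V" "p \<in> V" "Cinf_on F V"
      "\<And>x. x \<in> M \<inter> U \<inter> V \<Longrightarrow> F x = tang M x a"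
      using smooth_onE[of "M \<inter> U" "tfield M a" p] \<open>p \<in> M\<close> by blast
    ultimately show "\<exists>U F. open U \<and> p \<in> U \<and> Cinf_on F U \<and> (\<forall>x\<in>M \<inter> U. F x = tang M x a)"
      by (intro exI[of _ "U \<inter> V"] exI[of _ F]) (auto elim: Cinf_on_subset)
  qed
qed

lemma submanifold_dim_tangent_space:
  assumes "submanifold m M" "p \<in> M"
  shows "dim (tangent_space M p) = m"
  by (rule submanifold_local_retraction[OF assms])

context regular_subset
begin

lemma retractionE:
  assumes "p \<in> M"
  obtains U \<rho> where "open U" "p \<in> U" "Cinf_on \<rho> U" "\<rho> ` U \<subseteq> M" "\<And>x. x \<in> M \<inter> U \<Longrightarrow> \<rho> x = x"
    and "tangent_space M p = range (frechet_derivative \<rho> (at p))"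
proof -
  obtain U \<rho> where *: "open U" "p \<in> U" "Cinf_on \<rho> U" "\<rho> ` U \<subseteq> M" "\<And>x. x \<in> M \<inter> U \<Longrightarrow> \<rho> x = x"
    using retraction[OF assms] by auto
  then show ?thesis
    using tangent_space_retraction[OF *(1,2) assms Cinf_on_has_derivative[OF *(3,2)] *(4,5)]
    by (intro that[of U \<rho>])
qed

lemma subspace_tangent_space:
  assumes "p \<in> M"
  shows "subspace (tangent_space M p)"
proof -
  obtain U \<rho> where "open U" and \<rho>: "p \<in> U" "Cinf_on \<rho> U"
    and "\<rho> ` U \<subseteq> M" "\<And>x. x \<in> M \<inter> U \<Longrightarrow> \<rho> x = x"
    and T: "tangent_space M p = range (frechet_derivative \<rho> (at p))"
    by (rule retractionE[OF assms]) blast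
  have "linear (frechet_derivative \<rho> (at p))"
    using Cinf_on_has_derivative[OF \<rho>(2,1)] by (rule has_derivative_linear)
  then show ?thesis
    unfolding T by (simp add: linear_subspace_image)
qed

lemma linear_tang: "p \<in> M \<Longrightarrow> linear (tang M p)"
  unfolding tang_def[abs_def] by (rule linear_closest_point_subspace[OF subspace_tangent_space])

lemma tang_in: "p \<in> M \<Longrightarrow> tang M p a \<in> tangent_space M p"
  unfolding tang_def by (rule closest_point_in_subspace[OF subspace_tangent_space])

lemma tang_ident: "v \<in> tangent_space M p \<Longrightarrow> tang M p v = v"
  unfolding tang_def by (rule closest_point_self)

lemma tang_orthogonal: "p \<in> M \<Longrightarrow> v \<in> tangent_space M p \<Longrightarrow> (a - tang M p a) \<bullet> v = 0"
  unfolding tang_def by (rule closest_point_subspace_orthogonal[OF subspace_tangent_space])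

lemma tang_inner_tangent: "p \<in> M \<Longrightarrow> v \<in> tangent_space M p \<Longrightarrow> tang M p a \<bullet> v = a \<bullet> v"
  using tang_orthogonal[of p v a] by (simp add: inner_diff_left)

lemma tang_selfadjoint: "p \<in> M \<Longrightarrow> tang M p a \<bullet> b = a \<bullet> tang M p b"
  using tang_inner_tangent[OF _ tang_in, of p a b] tang_inner_tangent[OF _ tang_in, of p b a]
  by (simp add: inner_commute)

lemma tang_eq_0I:
  assumes "p \<in> M" "\<And>v. v \<in> tangent_space M p \<Longrightarrow> a \<bullet> v = 0"
  shows "tang M p a = 0"
  using assms tang_selfadjoint[OF assms(1), of a "tang M p a"] tang_in[OF assms(1)] tang_ident
  by (metis inner_eq_zero_iff)

lemma smooth_on_has_mderiv:
  assumes "smooth_on M f" "p \<in> M"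
  shows "(f has_derivative mderiv M f p) (at p within M)"
proof -
  obtain U F where U: "open U" "p \<in> U" "Cinf_on F U" "\<And>x. x \<in> M \<inter> U \<Longrightarrow> F x = f x"
    using smooth_onE[OF assms] by blast
  have "(F has_derivative frechet_derivative F (at p)) (at p within M)"
    using Cinf_on_has_derivative[OF U(3,2)] by (rule has_derivative_at_withinI)
  then have "(f has_derivative frechet_derivative F (at p)) (at p within M)"
    using U assms(2) by (blast intro: has_derivative_transform_on_open)
  then show ?thesis
    unfolding mderiv_def[abs_def] frechet_derivative_works[symmetric] differentiable_def by blast
qed

lemma linear_mderiv: "smooth_on M f \<Longrightarrow> p \<in> M \<Longrightarrow> linear (mderiv M f p)"
  using smooth_on_has_mderiv by (rule has_derivative_linear)

text \<open>The derivative within \<open>M\<close> is determined on tangent vectors, so any smooth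
  extension computes it there.\<close>

lemma mderiv_extension:
  assumes "open U" "p \<in> U" "Cinf_on F U" "\<And>x. x \<in> M \<inter> U \<Longrightarrow> F x = f x" "p \<in> M"
    and "v \<in> tangent_space M p"
  shows "mderiv M f p v = frechet_derivative F (at p) v"
proof -
  have "(F has_derivative frechet_derivative F (at p)) (at p within M)"
    using Cinf_on_has_derivative[OF assms(3,2)] by (rule has_derivative_at_withinI)
  then have "(f has_derivative frechet_derivative F (at p)) (at p within M)"
    using assms by (blast intro: has_derivative_transform_on_open)
  then show ?thesis
    using assms(6) by (rule mderivI)
qed

lemma mderiv_const: "v \<in> tangent_space M p \<Longrightarrow> mderiv M (\<lambda>x. c) p v = 0"
  by (rule mderivI) (auto intro: has_derivative_const)

lemma mderiv_ident: "v \<in> tangent_space M p \<Longrightarrow> mderiv M (\<lambda>x. x) p v = v"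
  by (rule mderivI) (auto intro: has_derivative_ident)

lemma mderiv_add:
  "smooth_on M f \<Longrightarrow> smooth_on M g \<Longrightarrow> p \<in> M \<Longrightarrow> v \<in> tangent_space M p \<Longrightarrow>
    mderiv M (\<lambda>x. f x + g x) p v = mderiv M f p v + mderiv M g p v"
  by (rule mderivI) (auto intro: has_derivative_add smooth_on_has_mderiv)

lemma mderiv_cmul:
  "smooth_on M f \<Longrightarrow> p \<in> M \<Longrightarrow> v \<in> tangent_space M p \<Longrightarrow>
    mderiv M (\<lambda>x. r *\<^sub>R f x) p v = r *\<^sub>R mderiv M f p v"
  by (rule mderivI) (auto intro: has_derivative_scaleR_right smooth_on_has_mderiv)

lemma mderiv_sum:
  "(\<And>i. i \<in> I \<Longrightarrow> smooth_on M (f i)) \<Longrightarrow> p \<in> M \<Longrightarrow> v \<in> tangent_space M p \<Longrightarrow>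
    mderiv M (\<lambda>x. \<Sum>i\<in>I. f i x) p v = (\<Sum>i\<in>I. mderiv M (f i) p v)"
  by (rule mderivI) (auto intro!: has_derivative_sum smooth_on_has_mderiv)

lemma mderiv_inner:
  "smooth_on M f \<Longrightarrow> smooth_on M g \<Longrightarrow> p \<in> M \<Longrightarrow> v \<in> tangent_space M p \<Longrightarrow>
    mderiv M (\<lambda>x. f x \<bullet> g x) p v = f p \<bullet> mderiv M g p v + mderiv M f p v \<bullet> g p"
  by (rule mderivI) (auto intro: has_derivative_inner smooth_on_has_mderiv)

lemma mderiv_inner_const:
  "smooth_on M f \<Longrightarrow> p \<in> M \<Longrightarrow> v \<in> tangent_space M p \<Longrightarrow>
    mderiv M (\<lambda>x. f x \<bullet> c) p v = mderiv M f p v \<bullet> c"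
  by (rule mderivI) (auto intro: has_derivative_inner_left smooth_on_has_mderiv)

lemma mderiv_zero: "smooth_on M f \<Longrightarrow> p \<in> M \<Longrightarrow> mderiv M f p 0 = 0"
  by (rule linear_0[OF linear_mderiv])

lemma smooth_on_mderiv:
  assumes "smooth_on M f" "smooth_vector_field M X"
  shows "smooth_on M (\<lambda>q. mderiv M f q (X q))"
proof (rule smooth_onI)
  fix p assume p: "p \<in> M"
  obtain U F where U: "open U" "p \<in> U" "Cinf_on F U" "\<And>x. x \<in> M \<inter> U \<Longrightarrow> F x = f x"
    using smooth_onE[OF assms(1) p] by blast
  obtain V G where V: "open V" "p \<in> V" "Cinf_on G V" "\<And>x. x \<in> M \<inter> V \<Longrightarrow> G x = X x"
    using smooth_onE[OF _ p] assms(2) unfolding smooth_vector_field_def by blast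
  let ?H = "\<lambda>x. \<Sum>b\<in>Basis. (G x \<bullet> b) *\<^sub>R frechet_derivative F (at x) b"
  have "?H x = mderiv M f x (X x)" if "x \<in> M \<inter> (U \<inter> V)" for x
  proof -
    have "mderiv M f x (X x) = frechet_derivative F (at x) (X x)"
      using that U assms(2) by (intro mderiv_extension[of U]) (auto simp: smooth_vector_field_def)
    also have "\<dots> = (\<Sum>b\<in>Basis. (X x \<bullet> b) *\<^sub>R frechet_derivative F (at x) b)"
      using that U(3) Cinf_on_has_derivative
      by (intro linear_euclidean_expansion) (blast intro: has_derivative_linear)
    finally show ?thesis
      using that V(4) by simp
  qed
  moreover have "Cinf_on ?H (U \<inter> V)"
    using U V by (intro Cinf_on_directional_derivative) (auto elim: Cinf_on_subset)
  ultimately show "\<exists>U F. open U \<and> p \<in> U \<and> Cinf_on F U \<and> (\<forall>x\<in>M \<inter> U. F x = mderiv M f x (X x))"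
    using U V by (intro exI[of _ "U \<inter> V"] exI[of _ ?H]) auto
qed

lemma smooth_vector_field_tfield: "smooth_vector_field M (tfield M a)"
  by (simp add: smooth_vector_field_def smooth_tang tang_in)

lemma smooth_on_tang:
  assumes "smooth_on M f"
  shows "smooth_on M (\<lambda>q. tang M q (f q))"
proof -
  have "smooth_on M (\<lambda>q. \<Sum>b\<in>Basis. (f q \<bullet> b) *\<^sub>R tang M q b)"
    by (intro smooth_on_sum smooth_on_scaleR smooth_on_inner assms smooth_on_const smooth_tang)
  then show ?thesis
    by (rule smooth_on_cong) (simp add: linear_euclidean_expansion[OF linear_tang, symmetric])
qed

text \<open>A product rule: one term differentiates the field, the other is the second derivative of
  the extension. The latter is symmetric in \<open>X p\<close> and \<open>v\<close> and therefore
  drops out of commutators.\<close>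

lemma second_mderiv:
  assumes U: "open U" "p \<in> U" "Cinf_on F U" "\<And>x. x \<in> M \<inter> U \<Longrightarrow> F x = f x" and p: "p \<in> M"
    and X: "smooth_vector_field M X" and v: "v \<in> tangent_space M p"
  shows "mderiv M (\<lambda>q. mderiv M f q (X q)) p v
    = frechet_derivative F (at p) (mderiv M X p v)
      + frechet_derivative (\<lambda>y. frechet_derivative F (at y) (X p)) (at p) v"
proof -
  have smX: "smooth_on M X"
    using X by (simp add: smooth_vector_field_def)
  obtain V G where V: "open V" "p \<in> V" "Cinf_on G V" "\<And>x. x \<in> M \<inter> V \<Longrightarrow> G x = X x"
    using smooth_onE[OF smX p] by blast
  let ?H = "\<lambda>x. \<Sum>b\<in>Basis. (G x \<bullet> b) *\<^sub>R frechet_derivative F (at x) b"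
  have lin: "linear (frechet_derivative F (at x))" if "x \<in> U" for x
    using Cinf_on_has_derivative[OF U(3) that] by (rule has_derivative_linear)
  have H: "?H x = mderiv M f x (X x)" if "x \<in> M \<inter> (U \<inter> V)" for x
  proof -
    have "mderiv M f x (X x) = frechet_derivative F (at x) (X x)"
      using that U X by (intro mderiv_extension[of U]) (auto simp: smooth_vector_field_def)
    then show ?thesis
      using that V(4) linear_euclidean_expansion[OF lin, of x "X x"] by simp
  qed
  have CH: "Cinf_on ?H (U \<inter> V)"
    using U V by (intro Cinf_on_directional_derivative) (auto elim: Cinf_on_subset)
  have Gp: "G p = X p"
    using V p by simp
  have DG: "(G has_derivative frechet_derivative G (at p)) (at p)"
    by (rule Cinf_on_has_derivative[OF V(3,2)])
  have DF: "((\<lambda>x. frechet_derivative F (at x) b) has_derivative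
      frechet_derivative (\<lambda>x. frechet_derivative F (at x) b) (at p)) (at p)" for b
    by (rule Cinf_on_has_derivative[OF Cinf_on_frechet_derivative[OF U(3)] U(2)])
  have DH: "(?H has_derivative (\<lambda>v. \<Sum>b\<in>Basis.
      (G p \<bullet> b) *\<^sub>R frechet_derivative (\<lambda>x. frechet_derivative F (at x) b) (at p) v
      + (frechet_derivative G (at p) v \<bullet> b) *\<^sub>R frechet_derivative F (at p) b)) (at p)"
    by (intro has_derivative_sum has_derivative_scaleR has_derivative_inner_left DG DF)
  have "mderiv M (\<lambda>q. mderiv M f q (X q)) p v = frechet_derivative ?H (at p) v"
    using U V H CH p v by (intro mderiv_extension[of "U \<inter> V"]) auto
  also have "\<dots> = (\<Sum>b\<in>Basis. (G p \<bullet> b) *\<^sub>R frechet_derivative (\<lambda>x. frechet_derivative F (at x) b) (at p) v)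
      + (\<Sum>b\<in>Basis. (frechet_derivative G (at p) v \<bullet> b) *\<^sub>R frechet_derivative F (at p) b)"
    by (simp add: frechet_derivative_eq[OF DH] sum.distrib)
  also have "(\<Sum>b\<in>Basis. (frechet_derivative G (at p) v \<bullet> b) *\<^sub>R frechet_derivative F (at p) b)
      = frechet_derivative F (at p) (mderiv M X p v)"
    using mderiv_extension[OF V p v]
    by (simp only: linear_euclidean_expansion[OF lin[OF U(2)], symmetric])
  also have "(\<Sum>b\<in>Basis. (G p \<bullet> b) *\<^sub>R frechet_derivative (\<lambda>x. frechet_derivative F (at x) b) (at p) v)
      = frechet_derivative (\<lambda>y. frechet_derivative F (at y) (X p)) (at p) v"
  proof -
    have "((\<lambda>x. \<Sum>b\<in>Basis. (X p \<bullet> b) *\<^sub>R frechet_derivative F (at x) b) has_derivative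
      (\<lambda>v. \<Sum>b\<in>Basis. (X p \<bullet> b) *\<^sub>R frechet_derivative (\<lambda>x. frechet_derivative F (at x) b) (at p) v)) (at p)"
      by (intro has_derivative_sum has_derivative_scaleR_right DF)
    then have "((\<lambda>x. frechet_derivative F (at x) (X p)) has_derivative
      (\<lambda>v. \<Sum>b\<in>Basis. (X p \<bullet> b) *\<^sub>R frechet_derivative (\<lambda>x. frechet_derivative F (at x) b) (at p) v)) (at p)"
      using U(1,2)
      by (rule has_derivative_transform_within_open)
        (simp add: linear_euclidean_expansion[OF lin, symmetric])
    then show ?thesis
      by (simp add: frechet_derivative_eq Gp)
  qed
  finally show ?thesis
    by simp
qed

text \<open>Let the retraction \<open>\<rho>\<close> serve as extension of the identity map. Its
  second derivatives cancel in the bracket, and what remains says that the derivative of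
  \<open>\<rho>\<close> at \<open>p\<close> fixes the bracket; the range of that derivative is the
  tangent space.\<close>

lemma lie_bracket_tangent:
  assumes X: "smooth_vector_field M X" and Y: "smooth_vector_field M Y" and p: "p \<in> M"
  shows "lie_bracket M X Y p \<in> tangent_space M p"
proof -
  obtain U \<rho> where \<rho>: "open U" "p \<in> U" "Cinf_on \<rho> U" and "\<rho> ` U \<subseteq> M"
    and id: "\<And>x. x \<in> M \<inter> U \<Longrightarrow> \<rho> x = x"
    and T: "tangent_space M p = range (frechet_derivative \<rho> (at p))"
    by (rule retractionE[OF p]) blast
  have lin: "linear (frechet_derivative \<rho> (at p))"
    using Cinf_on_has_derivative[OF \<rho>(3,2)] by (rule has_derivative_linear)
  have *: "mderiv M X p v = frechet_derivative \<rho> (at p) (mderiv M X p v)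
      + frechet_derivative (\<lambda>y. frechet_derivative \<rho> (at y) (X p)) (at p) v"
    if X: "smooth_vector_field M X" and v: "v \<in> tangent_space M p" for X v
  proof -
    have "mderiv M X p = mderiv M (\<lambda>q. mderiv M (\<lambda>x. x) q (X q)) p"
      using X by (intro mderiv_cong p) (simp add: mderiv_ident smooth_vector_field_def)
    then show ?thesis
      using second_mderiv[OF \<rho> id p X v] by simp
  qed
  have "lie_bracket M X Y p = frechet_derivative \<rho> (at p) (lie_bracket M X Y p)"
    using *[OF X, of "Y p"] *[OF Y, of "X p"] X Y p
      frechet_derivative_symmetric[OF \<rho>(1-3), of "X p" "Y p"]
    by (simp add: lie_bracket_def linear_diff[OF lin] smooth_vector_field_def)
      (metis add_diff_cancel_right)
  then show ?thesis
    unfolding T by (rule range_eqI)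
qed

text \<open>The same cancellation of second derivatives, for an extension of
  \<open>f\<close>.\<close>

lemma mderiv_lie_bracket:
  fixes f :: "'a \<Rightarrow> 'b::euclidean_space"
  assumes f: "smooth_on M f" and X: "smooth_vector_field M X" and Y: "smooth_vector_field M Y"
    and p: "p \<in> M"
  shows "mderiv M f p (lie_bracket M X Y p)
     = mderiv M (\<lambda>q. mderiv M f q (Y q)) p (X p) - mderiv M (\<lambda>q. mderiv M f q (X q)) p (Y p)"
proof -
  obtain U F where U: "open U" "p \<in> U" "Cinf_on F U" "\<And>x. x \<in> M \<inter> U \<Longrightarrow> F x = f x"
    using smooth_onE[OF f p] by blast
  have lin: "linear (frechet_derivative F (at p))"
    using Cinf_on_has_derivative[OF U(3,2)] by (rule has_derivative_linear)
  have "X p \<in> tangent_space M p" "Y p \<in> tangent_space M p"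
    using X Y p by (auto simp: smooth_vector_field_def)
  then show ?thesis
    using second_mderiv[OF U p X, of "Y p"] second_mderiv[OF U p Y, of "X p"]
      frechet_derivative_symmetric[OF U(1-3), of "X p" "Y p"]
      mderiv_extension[OF U p lie_bracket_tangent[OF X Y p]]
    by (simp add: lie_bracket_def linear_diff[OF lin])
qed

text \<open>As projections are self-adjoint and idempotent, the inner product of
  \<open>tfield M v\<close> and \<open>tfield M w\<close> equals that of \<open>tfield M w\<close>
  and the constant \<open>v\<close>. Differentiating this at \<open>p\<close> and cancelling the
  common term leaves the claim. So \<open>tfield M v\<close> acts at \<open>p\<close> like a field
  extended by normal coordinates, and correction terms with its covariant derivative vanish.\<close>

lemma tfield_parallel:
  assumes p: "p \<in> M" and u: "u \<in> tangent_space M p" and v: "v \<in> tangent_space M p"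
  shows "tang M p (mderiv M (tfield M v) p u) = 0"
proof (rule tang_eq_0I[OF p])
  fix w assume w: "w \<in> tangent_space M p"
  have "mderiv M (\<lambda>q. tang M q v \<bullet> tang M q w) p u = mderiv M (\<lambda>q. tang M q w \<bullet> v) p u"
  proof (rule fun_cong[OF mderiv_cong[OF p]])
    show "tang M q v \<bullet> tang M q w = tang M q w \<bullet> v" if "q \<in> M" for q
      using tang_inner_tangent[OF that tang_in[OF that, of w], of v] by (simp add: inner_commute)
  qed
  then show "mderiv M (tfield M v) p u \<bullet> w = 0"
    using p u by (simp add: mderiv_inner mderiv_inner_const smooth_tang tang_ident[OF v] tang_ident[OF w] inner_commute[of v])
qed

section \<open>Derivatives along projections of constant vectors\<close>

definition tderiv :: "'a \<Rightarrow> ('a \<Rightarrow> 'b::real_normed_vector) \<Rightarrow> 'a \<Rightarrow> 'b" where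
  "tderiv a f = (\<lambda>q. mderiv M f q (tang M q a))"

lemma tderiv_tangent: "v \<in> tangent_space M p \<Longrightarrow> tderiv v f p = mderiv M f p v"
  by (simp add: tderiv_def tang_ident)

lemma smooth_on_tderiv: "smooth_on M f \<Longrightarrow> smooth_on M (tderiv a f)"
  unfolding tderiv_def using smooth_vector_field_tfield by (rule smooth_on_mderiv[rotated])

lemma tderiv_cong: "p \<in> M \<Longrightarrow> (\<And>x. x \<in> M \<Longrightarrow> f x = g x) \<Longrightarrow> tderiv a f p = tderiv a g p"
  unfolding tderiv_def by (simp cong: mderiv_cong)

lemma tderiv_linear: "smooth_on M f \<Longrightarrow> p \<in> M \<Longrightarrow> linear (\<lambda>a. tderiv a f p)"
  unfolding tderiv_def using linear_compose[OF linear_tang linear_mderiv] by (simp add: o_def)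

lemma tderiv_tang: "p \<in> M \<Longrightarrow> tderiv (tang M p a) f p = tderiv a f p"
  by (simp add: tderiv_def tang_ident[OF tang_in])

lemma tderiv_add:
  "smooth_on M f \<Longrightarrow> smooth_on M g \<Longrightarrow> p \<in> M \<Longrightarrow>
    tderiv a (\<lambda>x. f x + g x) p = tderiv a f p + tderiv a g p"
  by (simp add: tderiv_def mderiv_add tang_in)

lemma tderiv_cmul: "smooth_on M f \<Longrightarrow> p \<in> M \<Longrightarrow> tderiv a (\<lambda>x. r *\<^sub>R f x) p = r *\<^sub>R tderiv a f p"
  by (simp add: tderiv_def mderiv_cmul tang_in)

lemma tderiv_inner:
  "smooth_on M f \<Longrightarrow> smooth_on M g \<Longrightarrow> p \<in> M \<Longrightarrow>
    tderiv a (\<lambda>x. f x \<bullet> g x) p = f p \<bullet> tderiv a g p + tderiv a f p \<bullet> g p"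
  by (simp add: tderiv_def mderiv_inner tang_in)

lemma tderiv_inner_const: "smooth_on M f \<Longrightarrow> p \<in> M \<Longrightarrow> tderiv a (\<lambda>x. f x \<bullet> c) p = tderiv a f p \<bullet> c"
  by (simp add: tderiv_def mderiv_inner_const tang_in)

lemma tderiv_const: "p \<in> M \<Longrightarrow> tderiv a (\<lambda>x. c) p = 0"
  by (simp add: tderiv_def mderiv_const tang_in)

lemma tderiv_ident: "p \<in> M \<Longrightarrow> tderiv a (\<lambda>x. x) p = tang M p a"
  by (simp add: tderiv_def mderiv_ident tang_in)

text \<open>Linear in both constant vectors, but tensorial only in \<open>a\<close>: for
  \<open>c\<close> the projection itself is differentiated, so the normal part of \<open>c\<close>
  may contribute.\<close>

lemma bilinear_tderiv_tderiv:
  assumes f: "smooth_on M f" and p: "p \<in> M"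
  shows "bilinear (\<lambda>a c. tderiv a (tderiv c f) p)"
  unfolding bilinear_def
proof (intro conjI allI)
  show "linear (\<lambda>a. tderiv a (tderiv c f) p)" for c
    by (intro tderiv_linear smooth_on_tderiv f p)
  show "linear (\<lambda>c. tderiv a (tderiv c f) p)" for a
  proof
    fix c d :: 'a and r :: real
    have "tderiv a (tderiv (c + d) f) p = tderiv a (\<lambda>q. tderiv c f q + tderiv d f q) p"
      by (rule tderiv_cong[OF p]) (simp add: linear_add[OF tderiv_linear[OF f]])
    then show "tderiv a (tderiv (c + d) f) p = tderiv a (tderiv c f) p + tderiv a (tderiv d f) p"
      by (simp add: tderiv_add smooth_on_tderiv f p)
    have "tderiv a (tderiv (r *\<^sub>R c) f) p = tderiv a (\<lambda>q. r *\<^sub>R tderiv c f q) p"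
      by (rule tderiv_cong[OF p]) (simp add: linear_cmul[OF tderiv_linear[OF f]])
    then show "tderiv a (tderiv (r *\<^sub>R c) f) p = r *\<^sub>R tderiv a (tderiv c f) p"
      by (simp add: tderiv_cmul smooth_on_tderiv f p)
  qed
qed

text \<open>This is the symmetry of the Hessian: both fields are parallel at \<open>p\<close>, so
  their bracket vanishes there.\<close>

lemma tderiv_commute:
  fixes f :: "'a \<Rightarrow> 'b::euclidean_space"
  assumes f: "smooth_on M f" and p: "p \<in> M" and u: "u \<in> tangent_space M p" and v: "v \<in> tangent_space M p"
  shows "tderiv u (tderiv v f) p = tderiv v (tderiv u f) p"
proof -
  let ?b = "lie_bracket M (tfield M u) (tfield M v) p"
  have "?b = tang M p ?b"
    by (intro tang_ident[symmetric] lie_bracket_tangent smooth_vector_field_tfield p)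
  also have "\<dots> = 0"
    by (simp add: lie_bracket_def linear_diff[OF linear_tang[OF p]] tang_ident u v tfield_parallel p)
  finally have "mderiv M f p ?b = 0"
    by (simp add: mderiv_zero f p)
  then show ?thesis
    using mderiv_lie_bracket[OF f smooth_vector_field_tfield smooth_vector_field_tfield p, of u v]
    by (simp add: tderiv_def)
qed

subsection \<open>Traces\<close>

definition tangent_basis :: "'a \<Rightarrow> 'a set" where
  "tangent_basis p = (SOME B. orthonormal_basis (tangent_space M p) B)"

lemma trace_at_eq: "trace_at M p q = (\<Sum>e\<in>tangent_basis p. q e)"
  by (simp add: trace_at_def tangent_basis_def)

lemma orthonormal_tangent_basis:
  assumes "p \<in> M"
  shows "orthonormal_basis (tangent_space M p) (tangent_basis p)"
proof -
  have "span (tangent_space M p) = tangent_space M p"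
    by (rule span_eq_iff[THEN iffD2, OF subspace_tangent_space[OF assms]])
  then obtain B where "B \<subseteq> tangent_space M p" "pairwise orthogonal B" "\<And>x. x \<in> B \<Longrightarrow> norm x = 1"
    "span B = tangent_space M p"
    using orthonormal_basis_subspace[OF subspace_tangent_space[OF assms]] by metis
  then have "orthonormal_basis (tangent_space M p) B"
    by (auto simp: orthonormal_basis_def)
  then show ?thesis
    unfolding tangent_basis_def by (rule someI)
qed

lemma tangent_basis_tangent: "p \<in> M \<Longrightarrow> e \<in> tangent_basis p \<Longrightarrow> e \<in> tangent_space M p"
  using orthonormal_tangent_basis by (auto simp: orthonormal_basis_def)

lemma tangent_basis_inner:
  assumes "p \<in> M" "e \<in> tangent_basis p" "d \<in> tangent_basis p"
  shows "e \<bullet> d = (if e = d then 1 else 0)"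
  using orthonormal_tangent_basis[OF assms(1)] assms(2,3)
  by (auto simp: orthonormal_basis_def pairwise_def orthogonal_def norm_eq_1)

lemma independent_tangent_basis:
  assumes "p \<in> M"
  shows "independent (tangent_basis p)"
proof -
  have "0 \<notin> tangent_basis p"
    using tangent_basis_inner[OF assms, of 0 0] by auto
  then show ?thesis
    using orthonormal_tangent_basis[OF assms] pairwise_orthogonal_independent
    by (auto simp: orthonormal_basis_def)
qed

lemma finite_tangent_basis: "p \<in> M \<Longrightarrow> finite (tangent_basis p)"
  by (rule independent_imp_finite[OF independent_tangent_basis])

lemma card_tangent_basis: "p \<in> M \<Longrightarrow> card (tangent_basis p) = dim (tangent_space M p)"
  using orthonormal_tangent_basis[of p] dim_span_eq_card_independent[OF independent_tangent_basis]
  unfolding orthonormal_basis_def by metis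

lemma tang_tangent_basis:
  assumes "p \<in> M"
  shows "tang M p a = (\<Sum>e\<in>tangent_basis p. (a \<bullet> e) *\<^sub>R e)"
proof -
  have span: "span (tangent_basis p) = tangent_space M p"
    using orthonormal_tangent_basis[OF assms] by (simp add: orthonormal_basis_def)
  have "closest_point (span (tangent_basis p)) a = (\<Sum>e\<in>tangent_basis p. (a \<bullet> e) *\<^sub>R e)"
  proof (rule closest_point_span_eqI)
    show "(\<Sum>e\<in>tangent_basis p. (a \<bullet> e) *\<^sub>R e) \<in> span (tangent_basis p)"
      by (intro span_sum span_scale span_base)
    fix d assume d: "d \<in> tangent_basis p"
    have "(\<Sum>e\<in>tangent_basis p. (a \<bullet> e) *\<^sub>R e) \<bullet> d = (\<Sum>e\<in>tangent_basis p. if e = d then a \<bullet> e else 0)"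
      unfolding inner_sum_left
      by (intro sum.cong refl) (simp add: tangent_basis_inner[OF assms _ d])
    then show "(a - (\<Sum>e\<in>tangent_basis p. (a \<bullet> e) *\<^sub>R e)) \<bullet> d = 0"
      using d finite_tangent_basis[OF assms] by (simp add: inner_diff_left)
  qed
  then show ?thesis
    by (simp add: tang_def span)
qed

text \<open>Expand \<open>tang M p a\<close> in the tangent basis and sum over \<open>a\<close>
  first. This trades a basis selected at each point for the fixed \<open>Basis\<close>, whose sums
  can be differentiated.\<close>

lemma sum_tangent_basis:
  assumes b: "bilinear b" and p: "p \<in> M"
  shows "(\<Sum>e\<in>tangent_basis p. b e e) = (\<Sum>a\<in>Basis. b a (tang M p a))"
proof -
  have lin: "linear (b x)" "linear (\<lambda>x. b x y)" for x y
    using b by (auto simp: bilinear_def)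
  have "(\<Sum>a\<in>Basis. b a (tang M p a)) = (\<Sum>a\<in>Basis. \<Sum>e\<in>tangent_basis p. (e \<bullet> a) *\<^sub>R b a e)"
    by (simp add: tang_tangent_basis[OF p] linear_sum[OF lin(1)] linear_cmul[OF lin(1)] inner_commute)
  also have "\<dots> = (\<Sum>e\<in>tangent_basis p. \<Sum>a\<in>Basis. (e \<bullet> a) *\<^sub>R b a e)"
    by (rule sum.swap)
  also have "\<dots> = (\<Sum>e\<in>tangent_basis p. b e e)"
    by (simp add: linear_euclidean_expansion[OF lin(2), symmetric])
  finally show ?thesis ..
qed

lemma sum_tangent_basis':
  assumes b: "bilinear b" and p: "p \<in> M"
  shows "(\<Sum>e\<in>tangent_basis p. b e e) = (\<Sum>a\<in>Basis. b (tang M p a) a)"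
  using sum_tangent_basis[of "\<lambda>x y. b y x", OF _ p] b by (simp add: bilinear_def)

section \<open>The trace of the Hessian\<close>

definition lap :: "('a \<Rightarrow> 'b::real_normed_vector) \<Rightarrow> 'a \<Rightarrow> 'b" where
  "lap f = (\<lambda>q. \<Sum>a\<in>Basis. tderiv a (tderiv a f) q)"

lemma smooth_on_lap: "smooth_on M f \<Longrightarrow> smooth_on M (lap f)"
  unfolding lap_def by (intro smooth_on_sum smooth_on_tderiv)

text \<open>The outer derivative sees only the projection of \<open>a\<close> at \<open>p\<close>,
  so the trace formula applies although the inner one is not tensorial.\<close>

lemma lap_eq_trace:
  assumes "smooth_on M f" "p \<in> M"
  shows "lap f p = (\<Sum>e\<in>tangent_basis p. tderiv e (tderiv e f) p)"
  using sum_tangent_basis'[OF bilinear_tderiv_tderiv[OF assms] assms(2)]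
  by (simp add: lap_def tderiv_tang assms(2))

lemma lap_cong: "p \<in> M \<Longrightarrow> (\<And>x. x \<in> M \<Longrightarrow> f x = g x) \<Longrightarrow> lap f p = lap g p"
  unfolding lap_def by (intro sum.cong refl tderiv_cong)

lemma lap_const: "p \<in> M \<Longrightarrow> lap (\<lambda>x. c) p = 0"
proof -
  assume p: "p \<in> M"
  have "tderiv a (tderiv a (\<lambda>x. c)) p = tderiv a (\<lambda>x. 0) p" for a
    by (rule tderiv_cong[OF p]) (simp add: tderiv_const)
  then show ?thesis
    by (simp add: lap_def tderiv_const p)
qed

lemma lap_add:
  assumes "smooth_on M f" "smooth_on M g" "p \<in> M"
  shows "lap (\<lambda>x. f x + g x) p = lap f p + lap g p"
proof -
  have "tderiv a (tderiv a (\<lambda>x. f x + g x)) p = tderiv a (\<lambda>x. tderiv a f x + tderiv a g x) p" for a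
    by (rule tderiv_cong) (simp_all add: tderiv_add assms)
  then show ?thesis
    by (simp add: lap_def tderiv_add smooth_on_tderiv assms sum.distrib)
qed

lemma lap_cmul:
  assumes "smooth_on M f" "p \<in> M"
  shows "lap (\<lambda>x. r *\<^sub>R f x) p = r *\<^sub>R lap f p"
proof -
  have "tderiv a (tderiv a (\<lambda>x. r *\<^sub>R f x)) p = tderiv a (\<lambda>x. r *\<^sub>R tderiv a f x) p" for a
    by (rule tderiv_cong) (simp_all add: tderiv_cmul assms)
  then show ?thesis
    by (simp add: lap_def tderiv_cmul smooth_on_tderiv assms scaleR_sum_right)
qed

lemma lap_inner_const:
  assumes "smooth_on M f" "p \<in> M"
  shows "lap (\<lambda>x. f x \<bullet> c) p = lap f p \<bullet> c"
proof -
  have "tderiv a (tderiv a (\<lambda>x. f x \<bullet> c)) p = tderiv a (\<lambda>x. tderiv a f x \<bullet> c) p" for a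
    by (rule tderiv_cong) (simp_all add: tderiv_inner_const assms)
  then show ?thesis
    by (simp add: lap_def tderiv_inner_const smooth_on_tderiv assms inner_sum_left)
qed

lemma lap_inner:
  assumes "smooth_on M f" "smooth_on M g" "p \<in> M"
  shows "lap (\<lambda>x. f x \<bullet> g x) p
    = f p \<bullet> lap g p + 2 * (\<Sum>a\<in>Basis. tderiv a f p \<bullet> tderiv a g p) + lap f p \<bullet> g p"
proof -
  have "tderiv a (tderiv a (\<lambda>x. f x \<bullet> g x)) p
      = tderiv a (\<lambda>x. f x \<bullet> tderiv a g x + tderiv a f x \<bullet> g x) p" for a
    by (rule tderiv_cong) (simp_all add: tderiv_inner assms)
  then show ?thesis
    by (simp add: lap_def tderiv_add tderiv_inner smooth_on_tderiv smooth_on_inner assms sum.distrib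
        inner_sum_left inner_sum_right sum_distrib_left)
qed

section \<open>The Laplacian\<close>

lemma levi_civita_eq: "levi_civita M X Y = (\<lambda>p. tang M p (mderiv M Y p (X p)))"
  by (simp add: levi_civita_def conn_def)

lemma gradient_eq:
  assumes f: "smooth_on M f" and p: "p \<in> M"
  shows "gradient M f p = (\<Sum>a\<in>Basis. tderiv a f p *\<^sub>R a)"
proof -
  let ?w = "\<Sum>a\<in>Basis. tderiv a f p *\<^sub>R a"
  have lin: "linear (\<lambda>a. tderiv a f p)"
    by (rule tderiv_linear[OF f p])
  have w: "?w \<bullet> c = tderiv c f p" for c
    using linear_euclidean_expansion[OF lin, of c]
    by (simp add: inner_sum_left inner_commute[of c] mult.commute)
  \<comment> \<open>The functional represented by \<open>?w\<close> depends only on the projection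
    of its argument, hence \<open>?w\<close> is tangent.\<close>
  have "tang M p ?w = ?w"
  proof (rule vector_eq_rdot[THEN iffD1, rule_format])
    show "tang M p ?w \<bullet> c = ?w \<bullet> c" for c
      using w[of c] w[of "tang M p c"] by (simp add: tang_selfadjoint[OF p] tderiv_tang[OF p])
  qed
  then have wT: "?w \<in> tangent_space M p"
    using tang_in[OF p] by metis
  show ?thesis
    unfolding gradient_def
  proof (rule the_equality)
    show "?w \<in> tangent_space M p \<and> (\<forall>v\<in>tangent_space M p. ?w \<bullet> v = mderiv M f p v)"
      using wT by (simp add: w tderiv_tangent)
    fix z assume z: "z \<in> tangent_space M p \<and> (\<forall>v\<in>tangent_space M p. z \<bullet> v = mderiv M f p v)"
    have "z - ?w \<in> tangent_space M p"
      using z wT by (intro subspace_diff[OF subspace_tangent_space[OF p]]) auto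
    then have "z \<bullet> (z - ?w) = ?w \<bullet> (z - ?w)"
      using z by (simp only: w tderiv_tangent)
    then have "(z - ?w) \<bullet> (z - ?w) = 0"
      by (simp add: inner_diff_left)
    then show "z = ?w"
      by simp
  qed
qed

lemma gradient_inner:
  assumes f: "smooth_on M f" and p: "p \<in> M"
  shows "gradient M f p \<bullet> c = tderiv c f p"
  using linear_euclidean_expansion[OF tderiv_linear[OF f p], of c]
  by (simp add: gradient_eq[OF f p] inner_sum_left inner_commute[of c] mult.commute)

lemma smooth_vector_field_gradient:
  assumes f: "smooth_on M f"
  shows "smooth_vector_field M (gradient M f)"
  unfolding smooth_vector_field_def
proof (intro conjI ballI)
  have "smooth_on M (\<lambda>p. \<Sum>a\<in>Basis. tderiv a f p *\<^sub>R a)"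
    by (intro smooth_on_sum smooth_on_scaleR smooth_on_tderiv smooth_on_const f)
  then show "smooth_on M (gradient M f)"
    by (rule smooth_on_cong) (simp add: gradient_eq[OF f])
  fix p assume p: "p \<in> M"
  have "tang M p (gradient M f p) = gradient M f p"
  proof (rule vector_eq_rdot[THEN iffD1, rule_format])
    show "tang M p (gradient M f p) \<bullet> c = gradient M f p \<bullet> c" for c
      by (simp add: tang_selfadjoint[OF p] gradient_inner[OF f p] tderiv_tang[OF p])
  qed
  then show "gradient M f p \<in> tangent_space M p"
    using tang_in[OF p] by metis
qed

lemma smooth_on_gradient: "smooth_on M f \<Longrightarrow> smooth_on M (gradient M f)"
  using smooth_vector_field_gradient by (simp add: smooth_vector_field_def)

lemma mderiv_gradient_inner:
  assumes f: "smooth_on M f" and p: "p \<in> M" and u: "u \<in> tangent_space M p"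
  shows "mderiv M (gradient M f) p u \<bullet> c = tderiv u (tderiv c f) p"
proof -
  have "mderiv M (gradient M f) p u \<bullet> c = mderiv M (\<lambda>q. gradient M f q \<bullet> c) p u"
    by (simp add: mderiv_inner_const smooth_on_gradient f p u)
  also have "\<dots> = mderiv M (tderiv c f) p u"
    by (intro fun_cong[OF mderiv_cong] p) (simp add: gradient_inner f)
  finally show ?thesis
    by (simp add: tderiv_tangent u)
qed

lemma mderiv_gradient_symmetric:
  assumes "smooth_on M f" "p \<in> M" "u \<in> tangent_space M p" "v \<in> tangent_space M p"
  shows "mderiv M (gradient M f) p u \<bullet> v = mderiv M (gradient M f) p v \<bullet> u"
  using assms tderiv_commute[OF assms] by (simp add: mderiv_gradient_inner)

lemma lap_eq_trace_gradient:
  assumes "smooth_on M f" "p \<in> M"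
  shows "lap f p = (\<Sum>e\<in>tangent_basis p. mderiv M (gradient M f) p e \<bullet> e)"
  unfolding lap_eq_trace[OF assms]
  by (intro sum.cong refl) (simp add: mderiv_gradient_inner assms tangent_basis_tangent)

lemma laplacian_eq_lap:
  assumes "smooth_on M f" "p \<in> M"
  shows "laplacian M f p = - lap f p"
  unfolding laplacian_def divergence_def trace_at_eq lap_eq_trace_gradient[OF assms] neg_equal_iff_equal
  by (intro sum.cong refl)
    (simp add: levi_civita_eq tang_inner_tangent assms tangent_basis_tangent tang_ident)

section \<open>The maximum principle\<close>

lemma tderiv_tderiv_le_0_at_max:
  assumes f: "smooth_on M f" and p: "p \<in> M" and max: "\<And>q. q \<in> M \<Longrightarrow> f q \<le> f p"
    and e: "e \<in> tangent_space M p"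
  shows "tderiv e (tderiv e f) p \<le> (0 :: real)"
proof -
  obtain U \<rho> where \<rho>: "open U" "p \<in> U" "Cinf_on \<rho> U" "\<rho> ` U \<subseteq> M" "\<And>x. x \<in> M \<inter> U \<Longrightarrow> \<rho> x = x"
    and "tangent_space M p = range (frechet_derivative \<rho> (at p))"
    by (rule retractionE[OF p]) blast
  obtain V F where V: "open V" "p \<in> V" "Cinf_on F V" "\<And>x. x \<in> M \<inter> V \<Longrightarrow> F x = f x"
    using smooth_onE[OF f p] by blast
  define W where "W = U \<inter> \<rho> -` V"
  \<comment> \<open>Composed with the retraction, the extension takes only values of
    \<open>f\<close> on \<open>M\<close>. The maximum over \<open>M\<close> thus becomes a maximum
    over the open set \<open>W\<close>.\<close>
  define G where "G = (\<lambda>x. F (\<rho> x))"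
  have "open W"
    unfolding W_def using \<rho> V by (intro continuous_open_preimage Cinf_on_continuous) auto
  moreover have "p \<in> W"
    using \<rho>(2,5) V(2) p by (auto simp: W_def)
  moreover from \<open>open W\<close> have "Cinf_on G W"
    unfolding G_def using \<rho>(3) V(3)
    by (intro Cinf_on_compose[of W \<rho> F V]) (auto simp: W_def elim: Cinf_on_subset)
  moreover have Gf: "G x = f (\<rho> x)" if "x \<in> W" for x
    using that \<rho>(4) V(4)[of "\<rho> x"] by (auto simp: G_def W_def)
  moreover have "G x = f x" if "x \<in> M \<inter> W" for x
    using that \<rho>(5)[of x] Gf[of x] by (auto simp: W_def)
  ultimately have W: "open W" "p \<in> W" "Cinf_on G W" "\<And>x. x \<in> M \<inter> W \<Longrightarrow> G x = f x"
    by auto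
  have Gmax: "G x \<le> G p" if "x \<in> W" for x
  proof -
    have "\<rho> x \<in> M"
      using that \<rho>(4) by (auto simp: W_def)
    then show ?thesis
      using max[of "\<rho> x"] Gf[OF that] W(2) W(4)[of p] p by simp
  qed
  have DG: "(G has_derivative frechet_derivative G (at x)) (at x)" if "x \<in> W" for x
    by (rule Cinf_on_has_derivative[OF W(3) that])
  have crit: "frechet_derivative G (at p) = (\<lambda>v. 0)"
    using W(1,2) DG Gmax by (intro differential_zero_maxmin[of p W G]) auto
  let ?G' = "\<lambda>x. frechet_derivative G (at x) e"
  let ?l = "frechet_derivative ?G' (at p) e"
  \<comment> \<open>The derivative of \<open>G\<close> vanishes at \<open>p\<close>, and with it the
    term of \<open>second_mderiv\<close> that differentiates the field.\<close>
  have "tderiv e (tderiv e f) p = ?l"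
    using second_mderiv[OF W p smooth_vector_field_tfield e, of e] crit
    by (simp add: tderiv_def tang_ident e)
  moreover have "\<not> ?l > 0"
  proof
    \<comment> \<open>A positive second derivative makes the derivative along \<open>e\<close>
      positive just after 0, and \<open>G\<close> would exceed its maximum.\<close>
    assume pos: "?l > 0"
    have "(?G' has_derivative frechet_derivative ?G' (at p)) (at p)"
      by (rule Cinf_on_has_derivative[OF Cinf_on_frechet_derivative[OF W(3)] W(2)])
    then have "((\<lambda>t. ?G' (p + t *\<^sub>R e)) has_real_derivative ?l) (at 0)"
      unfolding has_real_derivative_iff_has_vector_derivative by (rule has_vector_derivative_along_line)
    from DERIV_pos_inc_right[OF this pos]
    obtain d where d: "d > 0" "\<And>t. 0 < t \<Longrightarrow> t < d \<Longrightarrow> 0 < ?G' (p + t *\<^sub>R e)"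
      using crit by auto
    obtain r where r: "r > 0" "\<And>t. \<bar>t\<bar> < r \<Longrightarrow> p + t *\<^sub>R e \<in> W"
      using line_in_open[OF W(1,2)] by blast
    define s where "s = min d r / 2"
    have s: "0 < s" "s < d" "s < r"
      using d r by (auto simp: s_def)
    have DGt: "((\<lambda>t. G (p + t *\<^sub>R e)) has_real_derivative ?G' (p + t *\<^sub>R e)) (at t)" if "0 \<le> t" "t \<le> s" for t
    proof -
      have mem: "p + t *\<^sub>R e \<in> W"
        using that s by (intro r) auto
      have "((\<lambda>t. p + t *\<^sub>R e) has_derivative (\<lambda>h. h *\<^sub>R e)) (at t)"
        by (auto intro!: derivative_eq_intros)
      from has_derivative_compose[OF this DG[OF mem]]
      show ?thesis
        by (simp add: has_field_derivative_def linear_cmul[OF has_derivative_linear[OF DG[OF mem]]] mult_commute_abs)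
    qed
    have "\<exists>t>0. t < s \<and> G (p + s *\<^sub>R e) - G (p + 0 *\<^sub>R e) = (s - 0) * ?G' (p + t *\<^sub>R e)"
      by (rule MVT2[OF s(1)]) (rule DGt)
    then obtain t where t: "0 < t" "t < s" "G (p + s *\<^sub>R e) - G p = s * ?G' (p + t *\<^sub>R e)"
      by auto
    have "s * ?G' (p + t *\<^sub>R e) > 0"
      using d(2)[of t] t s by simp
    moreover have "G (p + s *\<^sub>R e) \<le> G p"
      using s by (intro Gmax r) auto
    ultimately show False
      using t(3) by simp
  qed
  ultimately show ?thesis
    by simp
qed

lemma lap_le_0_at_max:
  fixes f :: "'a \<Rightarrow> real"
  assumes "smooth_on M f" "p \<in> M" "\<And>q. q \<in> M \<Longrightarrow> f q \<le> f p"
  shows "lap f p \<le> 0"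
  unfolding lap_eq_trace[OF assms(1,2)]
  using assms by (intro sum_nonpos tderiv_tderiv_le_0_at_max tangent_basis_tangent)

lemma smooth_on_continuous_on: "smooth_on M f \<Longrightarrow> continuous_on M f"
  unfolding continuous_on_eq_continuous_within
  using smooth_on_has_mderiv has_derivative_continuous by blast

lemma laplace_eigenvalue_nonneg:
  assumes "compact M" "laplace_eigenvalue M \<mu>"
  shows "\<mu> \<ge> 0"
proof -
  obtain f p where f: "smooth_on M f" and p: "p \<in> M" "f p \<noteq> 0"
    and lap: "\<And>p. p \<in> M \<Longrightarrow> laplacian M f p = \<mu> * f p"
    using assms(2) unfolding laplace_eigenvalue_def by blast
  \<comment> \<open>The sign makes \<open>g p\<close> positive, so the maximum of \<open>g\<close>
    is positive as well.\<close>
  define g where "g = (\<lambda>x. sgn (f p) *\<^sub>R f x)"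
  have g: "smooth_on M g"
    unfolding g_def by (intro smooth_on_scaleR smooth_on_const f)
  obtain q where q: "q \<in> M" "\<And>x. x \<in> M \<Longrightarrow> g x \<le> g q"
    using continuous_attains_sup[OF assms(1) _ smooth_on_continuous_on[OF g]] p(1) by blast
  have "g p > 0"
    using p(2) by (simp add: g_def sgn_if)
  then have "g q > 0"
    using q(2)[OF p(1)] by simp
  moreover have "lap f q = - (\<mu> * f q)"
    using lap[OF q(1)] laplacian_eq_lap[OF f q(1)] by simp
  then have "\<mu> * g q = - lap g q"
    using lap_cmul[OF f q(1), of "sgn (f p)"] by (simp add: g_def)
  then have "\<mu> * g q \<ge> 0"
    using lap_le_0_at_max[OF g q] by simp
  ultimately show ?thesis
    by (simp add: zero_le_mult_iff)
qed

section \<open>Ricci curvature of gradient fields\<close>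

text \<open>Split \<open>a\<close> into tangential and normal parts. The normal-normal terms vanish
  by hypothesis; the mixed terms have trace zero since tangent vectors have no normal part. This
  serves for forms that are tensorial in neither argument.\<close>

lemma sum_tangent_basis_normal:
  assumes b: "bilinear b" and p: "p \<in> M"
    and 0: "\<And>a c. tang M p a = 0 \<Longrightarrow> tang M p c = 0 \<Longrightarrow> b a c = 0"
  shows "(\<Sum>e\<in>tangent_basis p. b e e) = (\<Sum>a\<in>Basis. b a a)"
proof -
  let ?P = "tang M p"
  have PP: "?P (?P a) = ?P a" for a
    by (rule tang_ident[OF tang_in[OF p]])
  have lin: "linear (b x)" "linear (\<lambda>x. b x y)" for x y
    using b by (auto simp: bilinear_def)
  have "bilinear (\<lambda>x y. b (x - ?P x) y)"
    unfolding bilinear_def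
    using lin(1) linear_compose[OF linear_compose_sub[OF linear_id linear_tang[OF p]] lin(2)]
    by (auto simp: o_def)
  from sum_tangent_basis[OF this p]
  have mixed: "(\<Sum>a\<in>Basis. b (a - ?P a) (?P a)) = 0"
    by (simp add: tang_ident tangent_basis_tangent p bilinear_lzero[OF b])
  have "b a a = b (?P a) a + b (a - ?P a) (?P a)" for a
  proof -
    have "b (a - ?P a) (a - ?P a) = 0"
      by (intro 0) (simp_all add: linear_diff[OF linear_tang[OF p]] PP)
    then show ?thesis
      by (simp add: bilinear_lsub[OF b] bilinear_rsub[OF b] algebra_simps)
  qed
  then have "(\<Sum>a\<in>Basis. b a a) = (\<Sum>a\<in>Basis. b (?P a) a)"
    by (simp add: sum.distrib mixed)
  then show ?thesis
    using sum_tangent_basis'[OF b p] by simp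
qed

text \<open>The formula \<open>Ric(X,X) = div(\<nabla>\<^sub>X X) - X(div X) -
  |\<nabla>X|\<^sup>2\<close> for a gradient field. The last term is due to the bracket of
  \<open>tfield M e\<close> and \<open>X\<close>, which at \<open>p\<close> equals the covariant
  derivative of \<open>X\<close> along \<open>e\<close>, and to the symmetry of the Hessian.\<close>

lemma ricci_gradient:
  fixes f :: "'a \<Rightarrow> real"
  defines "X \<equiv> gradient M f"
  assumes f: "smooth_on M f" and p: "p \<in> M"
  shows "ricci M X X p = (\<Sum>e\<in>tangent_basis p. mderiv M (levi_civita M X X) p e \<bullet> e)
    - mderiv M (lap f) p (X p) - (\<Sum>e\<in>tangent_basis p. (norm (tang M p (mderiv M X p e)))\<^sup>2)"
proof -
  have X: "smooth_vector_field M X" "smooth_on M X"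
    unfolding X_def by (intro smooth_vector_field_gradient smooth_on_gradient f)+
  have Xp: "X p \<in> tangent_space M p"
    using X(1) p by (simp add: smooth_vector_field_def)
  let ?h = "\<lambda>a q. tderiv a X q \<bullet> tang M q a"
  let ?Y = "\<lambda>e. levi_civita M (tfield M e) X"
  have h: "smooth_on M (?h a)" for a
    by (intro smooth_on_inner smooth_on_tderiv X smooth_tang)
  have curv: "curvature M (tfield M e) X X p \<bullet> e = mderiv M (levi_civita M X X) p e \<bullet> e
     - mderiv M (?h e) p (X p) - (norm (tang M p (mderiv M X p e)))\<^sup>2" if "e \<in> tangent_basis p" for e
  proof -
    have e: "e \<in> tangent_space M p"
      using that by (rule tangent_basis_tangent[OF p])
    have 1: "levi_civita M (tfield M e) (levi_civita M X X) p \<bullet> e = mderiv M (levi_civita M X X) p e \<bullet> e"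
      unfolding levi_civita_eq[of "tfield M e"] by (simp add: tang_inner_tangent p e tang_ident)
    have "smooth_on M (?Y e)"
      unfolding levi_civita_eq by (intro smooth_on_tang smooth_on_mderiv X smooth_vector_field_tfield)
    then have "levi_civita M X (?Y e) p \<bullet> e = mderiv M (\<lambda>q. ?Y e q \<bullet> e) p (X p)"
      unfolding levi_civita_eq[of X] by (simp add: tang_inner_tangent p e mderiv_inner_const Xp)
    also have "\<dots> = mderiv M (?h e) p (X p)"
      by (intro fun_cong[OF mderiv_cong[OF p]]) (simp add: levi_civita_eq tderiv_def tang_selfadjoint)
    finally have 2: "levi_civita M X (?Y e) p \<bullet> e = mderiv M (?h e) p (X p)" .
    define Z where "Z = lie_bracket M (tfield M e) X p"
    have Z: "Z \<in> tangent_space M p"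
      unfolding Z_def by (intro lie_bracket_tangent smooth_vector_field_tfield X p)
    have "Z = tang M p Z"
      using tang_ident[OF Z] ..
    also have "\<dots> = tang M p (mderiv M X p e)"
      by (simp add: Z_def lie_bracket_def linear_diff[OF linear_tang[OF p]] tang_ident e
          tfield_parallel p Xp)
    finally have Z': "Z = tang M p (mderiv M X p e)" .
    have "levi_civita M (lie_bracket M (tfield M e) X) X p \<bullet> e = mderiv M X p Z \<bullet> e"
      unfolding levi_civita_eq by (simp add: tang_inner_tangent p e Z_def)
    also have "\<dots> = mderiv M X p e \<bullet> Z"
      unfolding X_def by (rule mderiv_gradient_symmetric[OF f p Z e])
    also have "\<dots> = (norm (tang M p (mderiv M X p e)))\<^sup>2"
      using tang_inner_tangent[OF p Z, of "mderiv M X p e"] by (simp add: power2_norm_eq_inner Z')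
    finally show ?thesis
      by (simp add: curvature_def inner_diff_left 1 2)
  qed
  \<comment> \<open>The tangent basis belongs to the single point \<open>p\<close>, so its sum of
    the \<open>?h e\<close> is not yet a function to differentiate. The product rule gives a
    bilinear form at \<open>p\<close>, whose trace is moved to \<open>Basis\<close>; there the sum
    makes sense at every point.\<close>
  let ?b = "\<lambda>u v. tderiv u X p \<bullet> tderiv (X p) (tderiv v (\<lambda>x. x)) p
    + tderiv (X p) (tderiv u X) p \<bullet> tang M p v"
  have b: "mderiv M (?h a) p (X p) = ?b a a" for a
  proof -
    have "mderiv M (tderiv a (\<lambda>x. x)) p = mderiv M (tfield M a) p"
      by (intro mderiv_cong p) (simp add: tderiv_ident)
    then show ?thesis
      by (simp add: mderiv_inner smooth_on_tderiv smooth_tang X p Xp tderiv_tangent)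
  qed
  have "bilinear ?b"
  proof -
    note B1 = bilinear_tderiv_tderiv[OF X(2) p] and B2 = bilinear_tderiv_tderiv[OF smooth_on_ident p]
    note L = tderiv_linear[OF X(2) p] linear_tang[OF p]
    show ?thesis
      unfolding bilinear_def
      by (auto intro!: linearI simp: bilinear_radd[OF B1] bilinear_rmul[OF B1] bilinear_radd[OF B2]
          bilinear_rmul[OF B2] linear_add[OF L(1)] linear_cmul[OF L(1)] linear_add[OF L(2)]
          linear_cmul[OF L(2)] algebra_simps)
  qed
  \<comment> \<open>A normal \<open>a\<close> kills the first term, a normal \<open>c\<close> the
    second.\<close>
  moreover have "?b a c = 0" if "tang M p a = 0" "tang M p c = 0" for a c
  proof -
    have "tderiv a X p = 0"
      using that(1) by (simp add: tderiv_def mderiv_zero X p)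
    then show ?thesis
      using that(2) by simp
  qed
  ultimately have "(\<Sum>e\<in>tangent_basis p. ?b e e) = (\<Sum>a\<in>Basis. ?b a a)"
    by (intro sum_tangent_basis_normal p)
  then have "(\<Sum>e\<in>tangent_basis p. mderiv M (?h e) p (X p)) = (\<Sum>a\<in>Basis. mderiv M (?h a) p (X p))"
    by (simp only: b)
  also have "\<dots> = mderiv M (\<lambda>q. \<Sum>a\<in>Basis. ?h a q) p (X p)"
    by (simp only: mderiv_sum[OF h p Xp])
  also have "\<dots> = mderiv M (lap f) p (X p)"
  proof (intro fun_cong[OF mderiv_cong[OF p]])
    fix q assume q: "q \<in> M"
    have "bilinear (\<lambda>x y. tderiv x X q \<bullet> y)"
      unfolding bilinear_def
      by (auto intro!: linearI simp: linear_add[OF tderiv_linear[OF X(2) q]]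
          linear_cmul[OF tderiv_linear[OF X(2) q]] inner_add_left inner_add_right)
    from sum_tangent_basis[OF this q]
    show "(\<Sum>a\<in>Basis. ?h a q) = lap f q"
      by (simp add: lap_eq_trace_gradient[OF f q] tderiv_tangent tangent_basis_tangent q X_def)
  qed
  finally show ?thesis
    unfolding ricci_def trace_at_eq by (simp add: curv sum_subtractf)
qed

text \<open>The inequality \<open>(tr A)\<^sup>2 \<le> m |A|\<^sup>2\<close> for the Hessian:
  Cauchy-Schwarz in each summand of the trace, then over the basis.\<close>

lemma lap_squared_le:
  fixes f :: "'a \<Rightarrow> real"
  assumes "smooth_on M f" "p \<in> M"
  shows "(lap f p)\<^sup>2 \<le> real (dim (tangent_space M p))
    * (\<Sum>e\<in>tangent_basis p. (norm (tang M p (mderiv M (gradient M f) p e)))\<^sup>2)"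
proof -
  let ?n = "\<lambda>e. norm (tang M p (mderiv M (gradient M f) p e))"
  have "\<bar>lap f p\<bar> \<le> (\<Sum>e\<in>tangent_basis p. ?n e)"
    unfolding lap_eq_trace_gradient[OF assms]
  proof (rule order_trans[OF sum_abs], rule sum_mono)
    fix e assume e: "e \<in> tangent_basis p"
    then have "mderiv M (gradient M f) p e \<bullet> e = tang M p (mderiv M (gradient M f) p e) \<bullet> e"
      by (simp add: tang_inner_tangent tangent_basis_tangent assms(2))
    moreover have "norm e = 1"
      using tangent_basis_inner[OF assms(2) e e] by (simp add: norm_eq_1)
    ultimately show "\<bar>mderiv M (gradient M f) p e \<bullet> e\<bar> \<le> ?n e"
      using Cauchy_Schwarz_ineq2[of "tang M p (mderiv M (gradient M f) p e)" e] by simp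
  qed
  then have "(lap f p)\<^sup>2 \<le> (\<Sum>e\<in>tangent_basis p. ?n e)\<^sup>2"
    by (metis abs_ge_zero power2_abs power_mono)
  also have "\<dots> \<le> (\<Sum>e\<in>tangent_basis p. (?n e)\<^sup>2) * card (tangent_basis p)"
    by (rule sum_squared_le_sum_of_squares)
  finally show ?thesis
    by (simp add: card_tangent_basis assms(2) mult.commute)
qed

text \<open>Lichnerowicz' estimate. As the eigenmap \<open>y\<close> has constant length, Bochner's formula summed over
  its components holds without the divergence term, so no integration over \<open>M\<close> is needed.\<close>

lemma ricci_bound_of_eigenmap:
  fixes y :: "'a \<Rightarrow> 'a"
  assumes y: "smooth_on M y" and len: "\<And>q. q \<in> M \<Longrightarrow> y q \<bullet> y q = s"
    and lap: "\<And>q. q \<in> M \<Longrightarrow> lap y q = - \<mu> *\<^sub>R y q" and p: "p \<in> M"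
    and ric: "\<And>X. smooth_vector_field M X \<Longrightarrow> ricci M X X p \<ge> c * (X p \<bullet> X p)"
  shows "real (dim (tangent_space M p)) * (c * (\<mu> * s)) \<le> (real (dim (tangent_space M p)) - 1) * (\<mu>\<^sup>2 * s)"
proof -
  let ?m = "real (dim (tangent_space M p))"
  define f where "f = (\<lambda>b q. y q \<bullet> b)"
  define X where "X = (\<lambda>b. gradient M (f b))"
  have f: "smooth_on M (f b)" for b
    unfolding f_def by (intro smooth_on_inner y smooth_on_const)
  have lapf: "lap (f b) q = - \<mu> * f b q" if "q \<in> M" for b q
    unfolding f_def using that by (simp add: lap_inner_const y lap)
  have X: "smooth_vector_field M (X b)" "smooth_on M (X b)" for b
    unfolding X_def by (intro smooth_vector_field_gradient smooth_on_gradient f)+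
  have XT: "X b q \<in> tangent_space M q" if "q \<in> M" for b q
    using X(1) that by (simp add: smooth_vector_field_def)
  \<comment> \<open>The Laplacian of the constant \<open>y \<bullet> y\<close> vanishes, which gives
    \<open>|dy|\<^sup>2 = \<mu> s\<close>; this energy is then rewritten through the gradients of
    the components of \<open>y\<close>.\<close>
  have sumX: "(\<Sum>b\<in>Basis. X b q \<bullet> X b q) = \<mu> * s" if q: "q \<in> M" for q
  proof -
    have "0 = lap (\<lambda>q. y q \<bullet> y q) q"
      using lap_cong[OF q len] lap_const[OF q] by simp
    then have energy: "(\<Sum>a\<in>Basis. tderiv a y q \<bullet> tderiv a y q) = \<mu> * s"
      by (simp add: lap_inner y q lap len)
    have "(\<Sum>a\<in>Basis. tderiv a y q \<bullet> tderiv a y q)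
        = (\<Sum>a\<in>Basis. \<Sum>b\<in>Basis. (tderiv a (f b) q) * (tderiv a (f b) q))"
      by (subst euclidean_inner) (simp add: f_def tderiv_inner_const y q)
    also have "\<dots> = (\<Sum>b\<in>Basis. \<Sum>a\<in>Basis. (tderiv a (f b) q) * (tderiv a (f b) q))"
      by (rule sum.swap)
    also have "\<dots> = (\<Sum>b\<in>Basis. X b q \<bullet> X b q)"
      by (subst euclidean_inner) (simp add: X_def gradient_inner f q)
    finally show ?thesis
      using energy by simp
  qed
  have sumf: "(\<Sum>b\<in>Basis. (f b p)\<^sup>2) = s"
    using len[OF p] euclidean_inner[of "y p" "y p"] by (simp add: f_def power2_eq_square)
  have LC: "smooth_on M (levi_civita M (X b) (X b))" for b
    unfolding levi_civita_eq by (intro smooth_on_tang smooth_on_mderiv X)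
  \<comment> \<open>By symmetry of the Hessian the sum is half the gradient of the sum of all
    \<open>|X b|\<^sup>2\<close>, which is constant by \<open>sumX\<close>.\<close>
  have sumLC: "(\<Sum>b\<in>Basis. levi_civita M (X b) (X b) q) = 0" if q: "q \<in> M" for q
  proof -
    have "(\<Sum>b\<in>Basis. mderiv M (X b) q (X b q)) \<bullet> v = 0" if v: "v \<in> tangent_space M q" for v
    proof -
      have "0 = mderiv M (\<lambda>q. \<mu> * s) q v"
        by (rule mderiv_const[OF v, symmetric])
      also have "\<dots> = mderiv M (\<lambda>q. \<Sum>b\<in>Basis. X b q \<bullet> X b q) q v"
        by (intro fun_cong[OF mderiv_cong[OF q]]) (simp add: sumX)
      also have "\<dots> = (\<Sum>b\<in>Basis. 2 * (mderiv M (X b) q v \<bullet> X b q))"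
        by (simp add: mderiv_sum mderiv_inner smooth_on_inner X q v inner_commute)
      also have "\<dots> = 2 * (\<Sum>b\<in>Basis. mderiv M (X b) q (X b q) \<bullet> v)"
        unfolding X_def sum_distrib_left
        by (intro sum.cong refl)
          (simp add: mderiv_gradient_symmetric[OF f q v XT[OF q, unfolded X_def]])
      finally show ?thesis
        by (simp add: inner_sum_left)
    qed
    then have "tang M q (\<Sum>b\<in>Basis. mderiv M (X b) q (X b q)) = 0"
      by (rule tang_eq_0I[OF q])
    then show ?thesis
      by (simp add: levi_civita_eq linear_sum[OF linear_tang[OF q]])
  qed
  have div: "(\<Sum>b\<in>Basis. \<Sum>e\<in>tangent_basis p. mderiv M (levi_civita M (X b) (X b)) p e \<bullet> e) = 0"
  proof -
    have "(\<Sum>b\<in>Basis. mderiv M (levi_civita M (X b) (X b)) p e \<bullet> e) = 0" if "e \<in> tangent_basis p" for e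
    proof -
      have e: "e \<in> tangent_space M p"
        using that by (rule tangent_basis_tangent[OF p])
      have "(\<Sum>b\<in>Basis. mderiv M (levi_civita M (X b) (X b)) p e)
          = mderiv M (\<lambda>q. \<Sum>b\<in>Basis. levi_civita M (X b) (X b) q) p e"
        by (simp only: mderiv_sum[OF LC p e])
      also have "\<dots> = mderiv M (\<lambda>q. 0) p e"
        by (intro fun_cong[OF mderiv_cong[OF p]]) (rule sumLC)
      also have "\<dots> = 0"
        by (rule mderiv_const[OF e])
      finally show ?thesis
        by (simp add: inner_sum_left[symmetric])
    qed
    then show ?thesis
      by (subst sum.swap) simp
  qed
  let ?Q = "\<lambda>b. \<Sum>e\<in>tangent_basis p. (norm (tang M p (mderiv M (X b) p e)))\<^sup>2"
  have ricX: "ricci M (X b) (X b) p = (\<Sum>e\<in>tangent_basis p. mderiv M (levi_civita M (X b) (X b)) p e \<bullet> e)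
    - mderiv M (lap (f b)) p (X b p) - ?Q b" for b
    unfolding X_def by (rule ricci_gradient[OF f p])
  have "mderiv M (lap (f b)) p (X b p) = - \<mu> * (X b p \<bullet> X b p)" for b
  proof -
    have "mderiv M (lap (f b)) p (X b p) = mderiv M (\<lambda>q. (- \<mu>) *\<^sub>R f b q) p (X b p)"
      by (intro fun_cong[OF mderiv_cong[OF p]]) (simp add: lapf)
    also have "\<dots> = - \<mu> * mderiv M (f b) p (X b p)"
      using mderiv_cmul[OF f p XT[OF p], of "- \<mu>" b b] by simp
    finally show ?thesis
      using gradient_inner[OF f p, of b "X b p"] by (simp add: X_def tderiv_tangent XT[unfolded X_def] p)
  qed
  then have "(\<Sum>b\<in>Basis. ricci M (X b) (X b) p) = \<mu> * (\<Sum>b\<in>Basis. X b p \<bullet> X b p) - (\<Sum>b\<in>Basis. ?Q b)"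
    using div by (simp add: ricX sum_subtractf sum.distrib sum_distrib_left)
  moreover have "(\<Sum>b\<in>Basis. ricci M (X b) (X b) p) \<ge> (\<Sum>b\<in>Basis. c * (X b p \<bullet> X b p))"
    by (intro sum_mono ric X)
  ultimately have "c * (\<mu> * s) \<le> \<mu> * (\<mu> * s) - (\<Sum>b\<in>Basis. ?Q b)"
    using sumX[OF p] by (simp add: sum_distrib_left[symmetric])
  then have "?m * (c * (\<mu> * s)) \<le> ?m * (\<mu> * (\<mu> * s) - (\<Sum>b\<in>Basis. ?Q b))"
    by (rule mult_left_mono) simp
  \<comment> \<open>The Hessians are bounded below by the Laplacians of the components, whose
    squares add up to \<open>\<mu>\<^sup>2 s\<close> because \<open>y\<close> is an eigenmap of
    squared length \<open>s\<close>.\<close>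
  moreover have "\<mu>\<^sup>2 * s \<le> ?m * (\<Sum>b\<in>Basis. ?Q b)"
  proof -
    have "\<mu>\<^sup>2 * s = (\<Sum>b\<in>Basis. (lap (f b) p)\<^sup>2)"
      by (simp add: lapf p power_mult_distrib sum_distrib_left[symmetric] sumf)
    also have "\<dots> \<le> (\<Sum>b\<in>Basis. ?m * ?Q b)"
      unfolding X_def by (intro sum_mono lap_squared_le f p)
    finally show ?thesis
      by (simp add: sum_distrib_left)
  qed
  ultimately show ?thesis
    by (simp add: algebra_simps power2_eq_square)
qed

end

section \<open>The unit sphere\<close>

lemma tangent_space_sphere:
  fixes p :: "'a::euclidean_space"
  assumes "norm p = 1"
  shows "tangent_space (sphere 0 1) p = {v. v \<bullet> p = 0}"
proof (intro set_eqI iffI CollectI)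
  fix v assume "v \<in> tangent_space (sphere 0 1) p"
  then obtain \<gamma> \<epsilon> where \<gamma>: "\<epsilon> > 0" "\<gamma> 0 = p" "\<And>t. \<bar>t\<bar> < \<epsilon> \<Longrightarrow> \<gamma> t \<in> sphere 0 1"
    "(\<gamma> has_vector_derivative v) (at (0::real))"
    by (rule tangent_spaceE) blast
  have "((\<lambda>t. \<gamma> t \<bullet> \<gamma> t) has_vector_derivative \<gamma> 0 \<bullet> v + v \<bullet> \<gamma> 0) (at 0)"
    using has_derivative_inner[OF \<gamma>(4)[unfolded has_vector_derivative_def] \<gamma>(4)[unfolded has_vector_derivative_def]]
    by (simp add: has_vector_derivative_def algebra_simps)
  moreover have "((\<lambda>t. \<gamma> t \<bullet> \<gamma> t) has_vector_derivative 0) (at 0)"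
  proof (rule has_vector_derivative_transform_within_open[of "\<lambda>t. 1" _ _ "{-\<epsilon><..<\<epsilon>}"])
    show "1 = \<gamma> t \<bullet> \<gamma> t" if "t \<in> {-\<epsilon><..<\<epsilon>}" for t
      using \<gamma>(3)[of t] that by (auto simp: norm_eq_1)
  qed (use \<gamma>(1) in auto)
  ultimately have "\<gamma> 0 \<bullet> v + v \<bullet> \<gamma> 0 = 0"
    by (rule vector_derivative_unique_at)
  then show "v \<bullet> p = 0"
    by (simp add: \<gamma>(2) inner_commute)
next
  fix v assume "v \<in> {v. v \<bullet> p = 0}"
  then have v: "p \<bullet> v = 0" "v \<bullet> p = 0"
    by (auto simp: inner_commute)
  \<comment> \<open>The line \<open>p + t v\<close> is normalised. The factor is even in
    \<open>t\<close>, so the velocity at 0 remains \<open>v\<close>.\<close>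
  let ?n = "\<lambda>t. 1 + t\<^sup>2 * (v \<bullet> v)"
  let ?\<gamma> = "\<lambda>t. inverse (sqrt (?n t)) *\<^sub>R (p + t *\<^sub>R v)"
  have n: "?n t > 0" for t
    by (simp add: add_pos_nonneg)
  have "norm (?\<gamma> t) = 1" for t
  proof -
    have "(norm (p + t *\<^sub>R v))\<^sup>2 = ?n t"
      unfolding power2_norm_eq_inner
      using assms v by (simp add: norm_eq_1 inner_add_left inner_add_right power2_eq_square)
    then have "norm (p + t *\<^sub>R v) = sqrt (?n t)"
      by (simp add: real_sqrt_unique)
    then show ?thesis
      using n[of t] by simp
  qed
  moreover have "(?\<gamma> has_vector_derivative v) (at 0)"
    unfolding has_vector_derivative_def
    by (rule derivative_eq_intros refl | simp)+
  ultimately show "v \<in> tangent_space (sphere 0 1) p"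
    unfolding tangent_space_def by (intro CollectI exI[of _ ?\<gamma>] exI[of _ 1]) auto
qed

lemma tang_sphere:
  fixes p :: "'a::euclidean_space"
  assumes "norm p = 1"
  shows "tang (sphere 0 1) p w = w - (w \<bullet> p) *\<^sub>R p"
  unfolding tang_def tangent_space_sphere[OF assms]
proof (rule closest_point_subspace_eqI)
  show "subspace {v. v \<bullet> p = 0}"
    by (auto simp: subspace_def inner_add_left)
  show "w - (w \<bullet> p) *\<^sub>R p \<in> {v. v \<bullet> p = 0}"
    using assms by (simp add: norm_eq_1 inner_diff_left)
  show "(w - (w - (w \<bullet> p) *\<^sub>R p)) \<bullet> v = 0" if "v \<in> {v. v \<bullet> p = 0}" for v
    using that by (simp add: inner_commute[of p])
qed

lemma mderiv_tfield_sphere: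
  fixes q :: "'a::euclidean_space"
  assumes q: "norm q = 1" and z: "z \<bullet> q = 0"
  shows "mderiv (sphere 0 1) (tfield (sphere 0 1) b) q z = - ((b \<bullet> z) *\<^sub>R q + (b \<bullet> q) *\<^sub>R z)"
proof -
  have "mderiv (sphere 0 1) (tfield (sphere 0 1) b) q z = mderiv (sphere 0 1) (\<lambda>x. b - (b \<bullet> x) *\<^sub>R x) q z"
    using q by (intro fun_cong[OF mderiv_cong]) (auto simp: tang_sphere)
  also have "\<dots> = - ((b \<bullet> z) *\<^sub>R q + (b \<bullet> q) *\<^sub>R z)"
  proof (rule mderivI[where D = "\<lambda>z. - ((b \<bullet> z) *\<^sub>R q + (b \<bullet> q) *\<^sub>R z)"])
    show "((\<lambda>x. b - (b \<bullet> x) *\<^sub>R x) has_derivative (\<lambda>z. - ((b \<bullet> z) *\<^sub>R q + (b \<bullet> q) *\<^sub>R z)))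
        (at q within sphere 0 1)"
      by (auto intro!: derivative_eq_intros)
  qed (simp add: tangent_space_sphere q z)
  finally show ?thesis .
qed

lemma levi_civita_tfield_sphere:
  fixes q :: "'a::euclidean_space"
  assumes q: "norm q = 1"
  shows "levi_civita (sphere 0 1) (tfield (sphere 0 1) a) (tfield (sphere 0 1) b) q
    = - ((b \<bullet> q) *\<^sub>R (a - (a \<bullet> q) *\<^sub>R q))"
proof -
  have "(a - (a \<bullet> q) *\<^sub>R q) \<bullet> q = 0"
    using q by (simp add: inner_diff_left norm_eq_1)
  then show ?thesis
    using q by (simp add: levi_civita_def conn_def tang_sphere mderiv_tfield_sphere norm_eq_1
        inner_add_left inner_diff_left algebra_simps)
qed

lemma curvature_at_sphere:
  fixes p :: "'a::euclidean_space"
  assumes p: "norm p = 1" and u: "u \<bullet> p = 0" and v: "v \<bullet> p = 0" and w: "w \<bullet> p = 0"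
  shows "curvature_at (sphere 0 1) p u v w = (v \<bullet> w) *\<^sub>R u - (u \<bullet> w) *\<^sub>R v"
proof -
  let ?S = "sphere 0 1 :: 'a set"
  have tang: "tang ?S p x = x" if "x \<bullet> p = 0" for x
    using that p by (simp add: tang_sphere)
  \<comment> \<open>The inner covariant derivative is \<open>- (w \<bullet> q)\<close> times the
    projection of \<open>v\<close>. As \<open>w \<bullet> p = 0\<close>, only the derivative of this
    factor survives at \<open>p\<close>.\<close>
  have second: "levi_civita ?S (tfield ?S u) (levi_civita ?S (tfield ?S v) (tfield ?S w)) p = - ((w \<bullet> u) *\<^sub>R v)"
    if u: "u \<bullet> p = 0" and v: "v \<bullet> p = 0" for u v
  proof -
    have "mderiv ?S (levi_civita ?S (tfield ?S v) (tfield ?S w)) p u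
        = mderiv ?S (\<lambda>q. - ((w \<bullet> q) *\<^sub>R (v - (v \<bullet> q) *\<^sub>R q))) p u"
      using p by (intro fun_cong[OF mderiv_cong]) (auto simp: levi_civita_tfield_sphere)
    also have "\<dots> = - ((w \<bullet> u) *\<^sub>R v)"
    proof (rule mderivI[where D = "\<lambda>z. - ((w \<bullet> z) *\<^sub>R v)"])
      show "((\<lambda>q. - ((w \<bullet> q) *\<^sub>R (v - (v \<bullet> q) *\<^sub>R q))) has_derivative (\<lambda>z. - ((w \<bullet> z) *\<^sub>R v)))
          (at p within ?S)"
        using v w by (auto intro!: derivative_eq_intros)
    qed (simp add: tangent_space_sphere p u)
    finally show ?thesis
      by (simp add: levi_civita_def conn_def tang u v)
  qed
  \<comment> \<open>Both terms of the bracket equal \<open>- (u \<bullet> v) p\<close> and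
    cancel.\<close>
  have "lie_bracket ?S (tfield ?S u) (tfield ?S v) p = 0"
    by (simp add: lie_bracket_def tang u v mderiv_tfield_sphere p inner_commute[of u v])
  then have "levi_civita ?S (lie_bracket ?S (tfield ?S u) (tfield ?S v)) (tfield ?S w) p = 0"
    by (simp add: levi_civita_def conn_def mderiv_tfield_sphere p tang)
  then show ?thesis
    by (simp add: curvature_at_def curvature_def second u v inner_commute[of w])
qed

section \<open>Biharmonic submanifolds of the sphere\<close>

lemma tangent_space_mono: "M \<subseteq> N \<Longrightarrow> tangent_space M p \<subseteq> tangent_space N p"
  unfolding tangent_space_def by blast

locale spherical_submanifold = regular_subset M
  for M :: "'a::euclidean_space set" +
  fixes m :: nat
  assumes spherical: "M \<subseteq> sphere 0 1"
    and dim_tangent_space: "p \<in> M \<Longrightarrow> dim (tangent_space M p) = m"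
begin

lemma norm_position: "p \<in> M \<Longrightarrow> norm p = 1"
  using subsetD[OF spherical] by fastforce

lemma inner_self: "p \<in> M \<Longrightarrow> p \<bullet> p = 1"
  by (simp add: dot_square_norm norm_position)

lemma tangent_position: "p \<in> M \<Longrightarrow> v \<in> tangent_space M p \<Longrightarrow> v \<bullet> p = 0"
  using tangent_space_mono[OF spherical, of p] by (auto simp: tangent_space_sphere norm_position)

lemma tang_position: "p \<in> M \<Longrightarrow> tang M p a \<bullet> p = 0"
  by (rule tangent_position[OF _ tang_in])

lemma tang_sphere_M: "p \<in> M \<Longrightarrow> tang (sphere 0 1) p w = w - (w \<bullet> p) *\<^sub>R p"
  by (simp add: tang_sphere norm_position)

lemma smooth_position: "smooth_on M (tderiv a (\<lambda>x. x))"
  by (intro smooth_on_tderiv smooth_on_ident)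

section \<open>The Hessian of the position vector\<close>

lemma mderiv_tfield:
  assumes "p \<in> M" "e \<in> tangent_space M p"
  shows "mderiv M (tfield M e) p e = tderiv e (tderiv e (\<lambda>x. x)) p"
proof -
  have "mderiv M (tderiv e (\<lambda>x. x)) p = mderiv M (tfield M e) p"
    by (intro mderiv_cong assms(1)) (simp add: tderiv_ident)
  then show ?thesis
    by (simp add: tderiv_tangent[OF assms(2)])
qed

text \<open>The second derivative of the position is the derivative of a projected constant, which
  is parallel at \<open>p\<close>. It is the second fundamental form of \<open>M\<close> in the
  ambient Euclidean space.\<close>

lemma hessian_position_normal:
  assumes "p \<in> M" "e \<in> tangent_space M p" "v \<in> tangent_space M p"
  shows "tderiv e (tderiv e (\<lambda>x. x)) p \<bullet> v = 0"
  using tfield_parallel[OF assms(1,2,2)] tang_inner_tangent[OF assms(1,3)] mderiv_tfield[OF assms(1,2)]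
  by (metis inner_zero_left)

text \<open>Differentiate the orthogonality of position and tangent vectors: the radial part of the
  Euclidean second fundamental form is minus the metric.\<close>

lemma hessian_position_inner:
  assumes p: "p \<in> M" and e: "e \<in> tangent_basis p"
  shows "tderiv e (tderiv e (\<lambda>x. x)) p \<bullet> p = -1"
proof -
  have "0 = tderiv e (\<lambda>q. 0 :: real) p"
    by (simp add: tderiv_const p)
  also have "\<dots> = tderiv e (\<lambda>q. tderiv e (\<lambda>x. x) q \<bullet> q) p"
    by (rule tderiv_cong[OF p]) (simp add: tderiv_ident tang_position)
  also have "\<dots> = e \<bullet> e + tderiv e (tderiv e (\<lambda>x. x)) p \<bullet> p"
    by (simp add: tderiv_inner smooth_position smooth_on_ident p tderiv_ident tang_ident tangent_basis_tangent e)
  finally show ?thesis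
    by (simp add: tangent_basis_inner[OF p e e])
qed

text \<open>The Laplacian of the position has radial component \<open>- m\<close>; the added term
  cancels it and leaves the part tangent to the sphere. Written with \<open>lap\<close>, the field
  is visibly smooth.\<close>

definition tau :: "'a \<Rightarrow> 'a" where
  "tau = (\<lambda>q. lap (\<lambda>x. x) q + real m *\<^sub>R q)"

lemma smooth_tau: "smooth_on M tau"
  unfolding tau_def
  by (intro smooth_on_add smooth_on_scaleR smooth_on_const smooth_on_ident smooth_on_lap)

lemma levi_civita_tfield: "p \<in> M \<Longrightarrow> e \<in> tangent_space M p \<Longrightarrow> levi_civita M (tfield M e) (tfield M e) p = 0"
  by (simp add: levi_civita_eq tang_ident tfield_parallel)

lemma card_tangent_basis_eq: "p \<in> M \<Longrightarrow> card (tangent_basis p) = m"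
  by (simp add: card_tangent_basis dim_tangent_space)

text \<open>Projecting to the sphere removes the radial component -1 of each Hessian term, that is,
  adds \<open>p\<close>, once for each of the \<open>m\<close> basis vectors.\<close>

lemma tension_eq_tau:
  assumes p: "p \<in> M"
  shows "tension M (sphere 0 1) (\<lambda>x. x) p = tau p"
proof -
  have "hess_map M (sphere 0 1) (\<lambda>x. x) (tfield M e) (tfield M e) p = tderiv e (tderiv e (\<lambda>x. x)) p + p"
    if e: "e \<in> tangent_basis p" for e
  proof -
    note eT = tangent_basis_tangent[OF p e]
    have "pushforward M (\<lambda>x. x) (tfield M e) = tderiv e (\<lambda>x. x)"
      by (simp add: pushforward_def tderiv_def)
    then show ?thesis
      using eT p levi_civita_tfield[OF p eT] hessian_position_inner[OF p e]
      by (simp add: hess_map_def conn_def tang_ident tderiv_tangent tang_sphere_M pushforward_def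
          mderiv_zero smooth_on_ident)
  qed
  then show ?thesis
    by (simp add: tension_def trace_at_eq sum.distrib tau_def lap_eq_trace smooth_on_ident p
        sum_constant_scaleR card_tangent_basis_eq del: sum_constant)
qed

lemma mean_curvature_eq:
  assumes p: "p \<in> M"
  shows "mean_curvature m M (sphere 0 1) p = (1 / real m) *\<^sub>R tau p"
proof -
  have "second_fundamental_form M (sphere 0 1) (tfield M e) (tfield M e) p = tderiv e (tderiv e (\<lambda>x. x)) p + p"
    if e: "e \<in> tangent_basis p" for e
    using tangent_basis_tangent[OF p e] p hessian_position_inner[OF p e]
    by (simp add: second_fundamental_form_def conn_def tang_ident mderiv_tfield tang_sphere_M levi_civita_tfield)
  then show ?thesis
    by (simp add: mean_curvature_def trace_at_eq sum.distrib tau_def lap_eq_trace smooth_on_ident p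
        sum_constant_scaleR card_tangent_basis_eq del: sum_constant)
qed

lemma tau_normal:
  assumes p: "p \<in> M" and v: "v \<in> tangent_space M p"
  shows "tau p \<bullet> v = 0"
proof -
  have "lap (\<lambda>x. x) p \<bullet> v = 0"
    unfolding lap_eq_trace[OF smooth_on_ident p] inner_sum_left
    by (intro sum.neutral ballI hessian_position_normal tangent_basis_tangent p v)
  then show ?thesis
    using tangent_position[OF p v] by (simp add: tau_def inner_add_left inner_commute[of p])
qed

lemma tau_position:
  assumes p: "p \<in> M"
  shows "tau p \<bullet> p = 0"
proof -
  have "lap (\<lambda>x. x) p \<bullet> p = - real m"
    unfolding lap_eq_trace[OF smooth_on_ident p] inner_sum_left
    by (simp add: hessian_position_inner p card_tangent_basis_eq)
  then show ?thesis
    by (simp add: tau_def inner_add_left inner_self p)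
qed

lemma tau_lap_position: "p \<in> M \<Longrightarrow> tau p \<bullet> lap (\<lambda>x. x) p = tau p \<bullet> tau p"
  using tau_position[of p] by (simp add: tau_def inner_add_right)

text \<open>Differentiate \<open>tau q \<bullet> q = 0\<close>; the term with the derivative of
  \<open>q\<close> vanishes since \<open>tau\<close> is normal to \<open>M\<close>. First
  derivatives of \<open>tau\<close> are thus already tangent to the sphere.\<close>

lemma tderiv_tau_position:
  assumes p: "p \<in> M"
  shows "tderiv a tau p \<bullet> p = 0"
proof -
  have "0 = tderiv a (\<lambda>q. 0 :: real) p"
    by (simp add: tderiv_const p)
  also have "\<dots> = tderiv a (\<lambda>q. tau q \<bullet> q) p"
    by (rule tderiv_cong[OF p]) (simp add: tau_position)
  also have "\<dots> = tderiv a tau p \<bullet> p"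
    by (simp add: tderiv_inner smooth_tau smooth_on_ident p tderiv_ident tau_normal tang_in)
  finally show ?thesis ..
qed

text \<open>Apply \<open>lap\<close> to \<open>tau q \<bullet> q = 0\<close>. Since
  \<open>tau\<close> is orthogonal to tangent vectors, the sum of products of first derivatives is
  \<open>- |\<tau>|\<^sup>2\<close>; it counts twice, against one \<open>|\<tau>|\<^sup>2\<close>
  from the Laplacian of the position.\<close>

lemma lap_tau_position:
  assumes p: "p \<in> M"
  shows "lap tau p \<bullet> p = tau p \<bullet> tau p"
proof -
  have "tderiv a tau p \<bullet> tderiv a (\<lambda>x. x) p = - (tau p \<bullet> tderiv a (tderiv a (\<lambda>x. x)) p)" for a
  proof -
    have "0 = tderiv a (\<lambda>q. 0 :: real) p"
      by (simp add: tderiv_const p)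
    also have "\<dots> = tderiv a (\<lambda>q. tau q \<bullet> tderiv a (\<lambda>x. x) q) p"
      by (rule tderiv_cong[OF p]) (simp add: tderiv_ident tau_normal tang_in)
    finally show ?thesis
      by (simp add: tderiv_inner smooth_tau smooth_position p)
  qed
  then have "(\<Sum>a\<in>Basis. tderiv a tau p \<bullet> tderiv a (\<lambda>x. x) p) = - (tau p \<bullet> lap (\<lambda>x. x) p)"
    by (simp add: lap_def inner_sum_right sum_negf)
  moreover have "0 = lap (\<lambda>q. tau q \<bullet> q) p"
    using lap_cong[of p "\<lambda>q. tau q \<bullet> q" "\<lambda>q. 0"] by (simp add: tau_position lap_const p)
  ultimately show ?thesis
    by (simp add: lap_inner smooth_tau smooth_on_ident p tau_lap_position)
qed

section \<open>The bitension field of the inclusion\<close>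

lemma rough_laplacian_tension:
  assumes p: "p \<in> M"
  shows "rough_laplacian M (sphere 0 1) (\<lambda>x. x) (tension M (sphere 0 1) (\<lambda>x. x)) p
    = - (lap tau p - (tau p \<bullet> tau p) *\<^sub>R p)"
proof -
  let ?\<tau> = "tension M (sphere 0 1) (\<lambda>x. x)"
  have d\<tau>: "mderiv M ?\<tau> q = mderiv M tau q" if "q \<in> M" for q
    using that by (intro mderiv_cong) (simp_all add: tension_eq_tau)
  have summand: "conn M (sphere 0 1) (\<lambda>x. x) (tfield M e) (conn M (sphere 0 1) (\<lambda>x. x) (tfield M e) ?\<tau>) p
     - conn M (sphere 0 1) (\<lambda>x. x) (levi_civita M (tfield M e) (tfield M e)) ?\<tau> p
     = tderiv e (tderiv e tau) p - (tderiv e (tderiv e tau) p \<bullet> p) *\<^sub>R p"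
    if e: "e \<in> tangent_basis p" for e
  proof -
    note eT = tangent_basis_tangent[OF p e]
    \<comment> \<open>The inner projection to the sphere changes nothing, by
      \<open>tderiv_tau_position\<close>; only the outer one subtracts a radial part.\<close>
    have "mderiv M (conn M (sphere 0 1) (\<lambda>x. x) (tfield M e) ?\<tau>) p = mderiv M (tderiv e tau) p"
      using tderiv_tau_position
      by (intro mderiv_cong p) (simp add: conn_def d\<tau> tang_sphere_M tderiv_def)
    then show ?thesis
      using p eT levi_civita_tfield[OF p eT]
      by (simp add: conn_def[of M _ _ _ "conn M (sphere 0 1) (\<lambda>x. x) (tfield M e) ?\<tau>"]
          conn_def[of M _ _ "levi_civita M (tfield M e) (tfield M e)"]
          tang_ident tang_sphere_M d\<tau> mderiv_zero smooth_tau tderiv_tangent)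
  qed
  have "rough_laplacian M (sphere 0 1) (\<lambda>x. x) ?\<tau> p
      = - (\<Sum>e\<in>tangent_basis p. tderiv e (tderiv e tau) p - (tderiv e (tderiv e tau) p \<bullet> p) *\<^sub>R p)"
    unfolding rough_laplacian_def trace_at_eq by (intro arg_cong[where f=uminus] sum.cong refl summand)
  also have "\<dots> = - (lap tau p - (lap tau p \<bullet> p) *\<^sub>R p)"
    by (simp add: lap_eq_trace smooth_tau p sum_subtractf inner_sum_left scaleR_sum_left)
  finally show ?thesis
    by (simp add: lap_tau_position p)
qed

text \<open>On the unit sphere \<open>R(e, \<tau>) e = - \<tau>\<close> for a unit tangent vector
  \<open>e\<close> of \<open>M\<close>, because \<open>\<tau>\<close> is normal to \<open>M\<close>;
  the trace, taken with the minus sign, is \<open>m \<tau>\<close>.\<close>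

lemma bitension_eq:
  assumes p: "p \<in> M"
  shows "bitension M (sphere 0 1) (\<lambda>x. x) p = lap tau p - (tau p \<bullet> tau p) *\<^sub>R p + real m *\<^sub>R tau p"
proof -
  have "curvature_at (sphere 0 1) p (mderiv M (\<lambda>x. x) p e) (tension M (sphere 0 1) (\<lambda>x. x) p) (mderiv M (\<lambda>x. x) p e) = - tau p"
    if e: "e \<in> tangent_basis p" for e
    using tangent_basis_tangent[OF p e] p
    by (simp add: mderiv_ident tension_eq_tau curvature_at_sphere norm_position tangent_position tau_position
        tau_normal tangent_basis_inner[OF p e e])
  then show ?thesis
    by (simp add: bitension_def rough_laplacian_tension p trace_at_eq sum_constant_scaleR
        card_tangent_basis_eq del: sum_constant)
qed

section \<open>The eigenmap\<close>

definition eigenmap :: "real \<Rightarrow> 'a \<Rightarrow> 'a" where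
  "eigenmap h = (\<lambda>q. tau q + (real m * h) *\<^sub>R q)"

lemma smooth_eigenmap: "smooth_on M (eigenmap h)"
  unfolding eigenmap_def
  by (intro smooth_on_add smooth_on_scaleR smooth_tau smooth_on_const smooth_on_ident)

lemma eigenmap_inner_self:
  assumes "p \<in> M" "tau p \<bullet> tau p = (real m * h)\<^sup>2"
  shows "eigenmap h p \<bullet> eigenmap h p = 2 * (real m * h)\<^sup>2"
  using assms(2) tau_position[OF assms(1)]
  by (simp add: eigenmap_def inner_add_left inner_add_right inner_commute inner_self assms(1) power2_eq_square)

text \<open>The coefficients of \<open>tau\<close> and of the position become \<open>m h - m\<close>
  and \<open>m h (m h - m)\<close>, in the same ratio as in \<open>eigenmap\<close>.\<close>

lemma lap_eigenmap:
  assumes p: "p \<in> M" and "bitension M (sphere 0 1) (\<lambda>x. x) p = 0" and "tau p \<bullet> tau p = (real m * h)\<^sup>2"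
  shows "lap (eigenmap h) p = - (real m * (1 - h)) *\<^sub>R eigenmap h p"
proof -
  have 1: "lap tau p = (real m * h)\<^sup>2 *\<^sub>R p - real m *\<^sub>R tau p"
    using assms(2) by (simp add: bitension_eq p assms(3) algebra_simps)
  have 2: "lap (\<lambda>x. x) p = tau p - real m *\<^sub>R p"
    by (simp add: tau_def)
  have 3: "lap (eigenmap h) p = lap tau p + (real m * h) *\<^sub>R lap (\<lambda>x. x) p"
    unfolding eigenmap_def
    by (simp add: lap_add lap_cmul smooth_tau smooth_on_ident smooth_on_scaleR smooth_on_const p)
  show ?thesis
    unfolding 3 1 2 unfolding eigenmap_def by (simp add: algebra_simps power2_eq_square)
qed

end

section \<open>The eigenvalue bound and the Ricci bound\<close>

theorem corollary3p5:
  fixes M :: "'a::euclidean_space set" and m n :: nat and h :: real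
  assumes "DIM('a) = n + 1"
    and "submanifold m M" and "M \<subseteq> sphere 0 1" and "compact M"
    and "proper_biharmonic M (sphere 0 1)"
    and "\<forall>p\<in>M. norm (mean_curvature m M (sphere 0 1) p) = h" and "0 < h" and "h < 1"
  shows "first_eigenvalue M \<le> real m * (1 - h) \<and>
    (\<forall>c>0. (\<forall>X. smooth_vector_field M X \<longrightarrow> (\<forall>p\<in>M. ricci M X X p \<ge> c * (X p \<bullet> X p)))
      \<longrightarrow> c \<le> (real m - 1) * (1 - h))"
proof -
  interpret regular_subset M
    using assms(2) by (rule submanifold_regular_subset)
  interpret spherical_submanifold M m
    by unfold_locales (use assms(2,3) submanifold_dim_tangent_space in auto)
  let ?\<mu> = "real m * (1 - h)" and ?s = "2 * (real m * h)\<^sup>2" and ?y = "eigenmap h"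
  \<comment> \<open>\<open>M\<close> is non-empty, since an inclusion of the empty set would be
    harmonic.\<close>
  obtain p where p: "p \<in> M"
    using assms(5) by (auto simp: proper_biharmonic_def harmonic_map_def)
  \<comment> \<open>For \<open>m = 0\<close> the factor \<open>1 / real m\<close> is 0, so the mean
    curvature would vanish, against \<open>h > 0\<close>.\<close>
  have "m \<noteq> 0"
  proof
    assume "m = 0"
    then show False
      using p assms(6,7) by (simp add: mean_curvature_def)
  qed
  then have m: "real m > 0"
    by simp
  have \<mu>: "?\<mu> > 0" and s: "?s > 0"
    using m assms(7,8) by simp_all
  have "norm (tau q) = real m * h" if "q \<in> M" for q
    using assms(6) that m by (auto simp: mean_curvature_eq field_simps)
  then have tau: "tau q \<bullet> tau q = (real m * h)\<^sup>2" if "q \<in> M" for q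
    using that by (simp add: power2_norm_eq_inner[symmetric])
  have bih: "bitension M (sphere 0 1) (\<lambda>x. x) q = 0" if "q \<in> M" for q
    using assms(5) that by (simp add: proper_biharmonic_def biharmonic_map_def)
  have len: "?y q \<bullet> ?y q = ?s" if "q \<in> M" for q
    using that by (intro eigenmap_inner_self tau)
  have lap: "lap ?y q = - ?\<mu> *\<^sub>R ?y q" if "q \<in> M" for q
    using that by (intro lap_eigenmap bih tau)
  have "?y p \<noteq> 0"
    using len[OF p] s by auto
  \<comment> \<open>A component of \<open>?y\<close> that does not vanish at \<open>p\<close> serves
    as eigenfunction.\<close>
  then obtain b where b: "b \<in> Basis" "?y p \<bullet> b \<noteq> 0"
    using euclidean_eq_iff[of "?y p" 0] by auto
  have f: "smooth_on M (\<lambda>q. ?y q \<bullet> b)"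
    by (intro smooth_on_inner smooth_eigenmap smooth_on_const)
  have "laplacian M (\<lambda>q. ?y q \<bullet> b) q = ?\<mu> * (?y q \<bullet> b)" if "q \<in> M" for q
    using laplacian_eq_lap[OF f that] lap_inner_const[OF smooth_eigenmap that, of h b] lap[OF that] by simp
  then have "laplace_eigenvalue M ?\<mu>"
    unfolding laplace_eigenvalue_def using f p b(2) by blast
  moreover have "bdd_below {\<mu>. \<mu> \<noteq> 0 \<and> laplace_eigenvalue M \<mu>}"
    using laplace_eigenvalue_nonneg[OF assms(4)] by (intro bdd_belowI[of _ 0]) auto
  \<comment> \<open>As \<open>h < 1\<close>, the eigenvalue \<open>?\<mu>\<close> is not 0 and
    belongs to the set whose infimum is taken.\<close>
  ultimately have "first_eigenvalue M \<le> ?\<mu>"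
    unfolding first_eigenvalue_def using m assms(8) by (intro cInf_lower) auto
  moreover have "c \<le> (real m - 1) * (1 - h)"
    if "\<forall>X. smooth_vector_field M X \<longrightarrow> (\<forall>p\<in>M. ricci M X X p \<ge> c * (X p \<bullet> X p))" for c
  proof -
    have "real m * (c * (?\<mu> * ?s)) \<le> (real m - 1) * (?\<mu>\<^sup>2 * ?s)"
      using ricci_bound_of_eigenmap[OF smooth_eigenmap len lap p, of c] that p
      by (simp add: dim_tangent_space)
    \<comment> \<open>One factor \<open>?\<mu>\<close> is read as \<open>m (1 - h)\<close>; the
      positive number \<open>m ?\<mu> ?s\<close> then cancels. The estimate at the single point
      \<open>p\<close> is enough.\<close>
    then have "(real m * ?\<mu> * ?s) * c \<le> (real m * ?\<mu> * ?s) * ((real m - 1) * (1 - h))"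
      by (simp add: power2_eq_square mult_ac)
    moreover have "real m * ?\<mu> * ?s > 0"
      using m \<mu> s by simp
    ultimately show ?thesis
      by (simp only: mult_le_cancel_left_pos)
  qed
  ultimately show ?thesis
    by blast
qed

end
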